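(* Let $\pi_R$ be the right regular action of the bialgebra $s03$ on $S03$ described in the context. The subspace $W_N\subset S03$ spanned by the basis words of length $N$ is invariant, $\tilde A$ acts on it as $N$, and: (0) $W_0=\mathbb{C}1$ is the trivial representation ($\tilde A,\tilde B,\tilde C,\tilde D$ act by zero). (1) $W_1$ is four-dimensional and is the direct sum of two isomorphic two-dimensional irreducible representations with bases $(v^1_0,v^1_1)=(\tilde a+\tilde d,\tilde b+\tilde c)$ and $(v^2_0,v^2_1)=(\tilde b-\tilde c,\tilde a-\tilde d)$, on which $$\tilde B:v^k_0\mapsto v^k_1,\ v^k_1\mapsto v^k_0;\quad \tilde C:v^k_0\mapsto-v^k_1,\ v^k_1\mapsto v^k_0;\quad \tilde D:v^k_0\mapsto v^k_0,\ v^k_1\mapsto-v^k_1 .$$ (2) $W_2$ is eight-dimensional and is the direct sum of the eight one-dimensional representations spanned by $v^1_{\epsilon,\epsilon'}=(\tilde a+\epsilon\tilde b)(\tilde a+i\epsilon'\tilde c)$ and $v^2_{\epsilon,\epsilon'}=(\tilde d+\epsilon\tilde c)(\tilde d+i\epsilon'\tilde b)$, $\epsilon,\epsilon'\in\{\pm1\}$. (3) For $N>2$, $W_N$ is a direct sum of one-dimensional representations spanned by vectors of the form $(\tilde a+\epsilon\tilde b)f_1(\tilde a+i\epsilon'\tilde c)$, $(\tilde d+\epsilon\tilde c)f_2(\tilde d+i\epsilon'\tilde b)$, $(\tilde a+\epsilon\tilde b)f_3(\tilde d+i\epsilon'\tilde b)$, $(\tilde d+\epsilon\tilde c)f_4(\tilde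 a+i\epsilon'\tilde c)$, with $f_j$ basis words of length $N-2$ for which the vector is nonzero. On each of the one-dimensional representations in (2) and (3) the action is $\tilde B\mapsto\epsilon$, $\tilde C\mapsto i\epsilon'$, $\tilde D\mapsto0$; hence for each $N\ge2$ there are exactly four non-isomorphic irreducible representations occurring in $W_N$, parametrized by $(\epsilon,\epsilon')$.
   Context: $S03$ is the unital associative $\mathbb{C}$-algebra generated by $\tilde a,\tilde b,\tilde c,\tilde d$ with relations $\tilde b^2=\tilde c^2=0$, $\tilde a\tilde d=\tilde d\tilde a=0$, $\tilde a\tilde b=0$, $\tilde b\tilde d=0$, $\tilde d\tilde c=0$, $\tilde c\tilde a=0$. Its basis consists of the words in $\tilde a,\tilde b,\tilde c,\tilde d$ (including the empty word $1$) containing none of these forbidden adjacent pairs; the length of a word is its number of letters. It is a bialgebra with $\delta\tilde a=\tilde a\otimes\tilde a+\tilde b\otimes\tilde b-\tilde c\otimes\tilde c+\tilde d\otimes\tilde d$, $\delta\tilde b=\tilde a\otimes\tilde b+\tilde b\otimes\tilde a-\tilde c\otimes\tilde d+\tilde d\otimes\tilde c$, $\delta\tilde c=\tilde a\otimes\tilde c+\tilde c\otimes\tilde a-\tilde b\otimes\tilde d+\tilde d\otimes\tilde b$, $\delta\tilde d=\tilde a\otimes\tilde d+\tilde d\otimes\tilde a-\tilde b\otimes\tilde c+\tilde c\otimes\tilde b$, $\varepsilon(\tilde a)=1$, $\varepsilon(\tilde b)=\varepsilon(\tilde c)=\varepsilon(\tilde d)=0$. $s03$ is the unital algebra generated by the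 linear functionals on $S03$ given on basis words $f$ ($k\ge0$) by: $\langle\tilde A,f\rangle=k$ if $f=\tilde a^k$, else $0$; $\langle\tilde B,f\rangle=1$ if $f=\tilde b\tilde a^k$, else $0$; $\langle\tilde C,f\rangle=1$ if $f=\tilde a^k\tilde c$, else $0$; $\langle\tilde D,f\rangle=1$ if $f=\tilde d$, else $0$; with product $\langle uv,f\rangle=\langle u\otimes v,\delta(f)\rangle$ and unit $\varepsilon$. The right regular action is $\pi_R(Z)f=f_{(1)}\langle Z,f_{(2)}\rangle$ with $\delta(f)=f_{(1)}\otimes f_{(2)}$ (Sweedler notation). *)

theory Defs
  imports Complex_Main "HOL-Library.Poly_Mapping" "HOL-Library.Product_Plus"
begin

section \<open>Complex unital associative algebras\<close>

class complex_algebra_1 = ring_1 +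
  fixes scaleC :: "complex \<Rightarrow> 'a \<Rightarrow> 'a" (infixr "*\<^sub>C" 75)
  assumes scaleC_add_right: "c *\<^sub>C (x + y) = c *\<^sub>C x + c *\<^sub>C y"
    and scaleC_add_left: "(c + d) *\<^sub>C x = c *\<^sub>C x + d *\<^sub>C x"
    and scaleC_scaleC: "c *\<^sub>C (d *\<^sub>C x) = (c * d) *\<^sub>C x"
    and scaleC_one: "1 *\<^sub>C x = x"
    and mult_scaleC_left: "(c *\<^sub>C x) * y = c *\<^sub>C (x * y)"
    and mult_scaleC_right: "x * (c *\<^sub>C y) = c *\<^sub>C (x * y)"

global_interpretation cvs: vector_space "scaleC :: complex \<Rightarrow> 'a \<Rightarrow> 'a::complex_algebra_1"
  by standard (simp_all add: scaleC_add_right scaleC_add_left scaleC_scaleC scaleC_one)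

abbreviation clinear :: "('a::complex_algebra_1 \<Rightarrow> 'b::complex_algebra_1) \<Rightarrow> bool" where
  "clinear \<equiv> Vector_Spaces.linear scaleC scaleC"

lemma clinearI:
  fixes f :: "'a::complex_algebra_1 \<Rightarrow> 'b::complex_algebra_1"
  assumes "\<And>x y. f (x + y) = f x + f y" "\<And>c x. f (c *\<^sub>C x) = c *\<^sub>C f x"
  shows "clinear f"
  using assms by unfold_locales auto

lemma clinearD:
  fixes f :: "'a::complex_algebra_1 \<Rightarrow> 'b::complex_algebra_1"
  assumes "clinear f"
  shows "f (x + y) = f x + f y" "f (c *\<^sub>C x) = c *\<^sub>C f x" "f 0 = 0" "f (x - y) = f x - f y"
    "f (- x) = - f x"
proof -
  interpret Vector_Spaces.linear scaleC scaleC f by (rule assms)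
  show "f (x + y) = f x + f y" "f (c *\<^sub>C x) = c *\<^sub>C f x" "f 0 = 0" "f (x - y) = f x - f y"
    "f (- x) = - f x"
    by (simp_all add: add scale zero diff neg)
qed

instantiation complex :: complex_algebra_1
begin
definition scaleC_complex :: "complex \<Rightarrow> complex \<Rightarrow> complex" where
  "scaleC_complex c x = c * x"
instance by standard (simp_all add: scaleC_complex_def algebra_simps)
end

lemma lookup_map_scaleC:
  fixes p :: "'k \<Rightarrow>\<^sub>0 'a::complex_algebra_1"
  shows "Poly_Mapping.lookup (Poly_Mapping.map (scaleC c) p) k = c *\<^sub>C Poly_Mapping.lookup p k"
  by (simp add: Poly_Mapping.map.rep_eq when_def)

lemma poly_mapping_induct_single [case_names zero single add]:
  assumes "P 0" and "\<And>k c. P (Poly_Mapping.single k c)" and "\<And>p q. P p \<Longrightarrow> P q \<Longrightarrow> P (p + q)"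
  shows "P (p :: 'k \<Rightarrow>\<^sub>0 'a::comm_monoid_add)"
proof (induction p rule: update_induct)
  case const
  show ?case by (rule assms(1))
next
  case (update p k c)
  have "Poly_Mapping.update k c p = p + Poly_Mapping.single k c"
    using update(1)
    by (intro poly_mapping_eqI)
       (auto simp: lookup_update lookup_add lookup_single in_keys_iff when_def)
  then show ?case using assms update by simp
qed

lemma map_scaleC_single:
  "Poly_Mapping.map (scaleC c) (Poly_Mapping.single k x) = Poly_Mapping.single k (c *\<^sub>C x)"
  by (intro poly_mapping_eqI) (simp add: lookup_map_scaleC lookup_single when_def)

lemma map_scaleC_add:
  fixes p :: "'k \<Rightarrow>\<^sub>0 'a::complex_algebra_1"
  shows "Poly_Mapping.map (scaleC c) (p + q)
    = Poly_Mapping.map (scaleC c) p + Poly_Mapping.map (scaleC c) q"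
  by (intro poly_mapping_eqI) (simp add: lookup_map_scaleC lookup_add scaleC_add_right)

lemma map_scaleC_mult:
  fixes p q :: "'k::monoid_add \<Rightarrow>\<^sub>0 'a::complex_algebra_1"
  shows "Poly_Mapping.map (scaleC c) p * q = Poly_Mapping.map (scaleC c) (p * q)"
    and "p * Poly_Mapping.map (scaleC c) q = Poly_Mapping.map (scaleC c) (p * q)"
proof -
  have z: "Poly_Mapping.map (scaleC c) 0 = (0 :: 'k \<Rightarrow>\<^sub>0 'a)"
    by (intro poly_mapping_eqI) (simp add: lookup_map_scaleC)
  have s: "Poly_Mapping.map (scaleC c) (Poly_Mapping.single k x) * q
      = Poly_Mapping.map (scaleC c) (Poly_Mapping.single k x * q)"
    "Poly_Mapping.single k x * Poly_Mapping.map (scaleC c) q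
      = Poly_Mapping.map (scaleC c) (Poly_Mapping.single k x * q)" for k and x :: 'a
    by (induction q rule: poly_mapping_induct_single)
       (simp_all add: map_scaleC_single mult_single mult_scaleC_left mult_scaleC_right
          map_scaleC_add distrib_left distrib_right z)
  show "Poly_Mapping.map (scaleC c) p * q = Poly_Mapping.map (scaleC c) (p * q)"
    and "p * Poly_Mapping.map (scaleC c) q = Poly_Mapping.map (scaleC c) (p * q)"
    by (induction p rule: poly_mapping_induct_single)
       (simp_all add: s[unfolded map_scaleC_single] map_scaleC_single z map_scaleC_add distrib_left
          distrib_right)
qed

instantiation poly_mapping :: (monoid_add, complex_algebra_1) complex_algebra_1
begin
definition scaleC_poly_mapping :: "complex \<Rightarrow> ('a \<Rightarrow>\<^sub>0 'b) \<Rightarrow> 'a \<Rightarrow>\<^sub>0 'b" where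
  "scaleC_poly_mapping c = Poly_Mapping.map (scaleC c)"
instance
proof
  fix c d :: complex and x y :: "'a \<Rightarrow>\<^sub>0 'b"
  show "c *\<^sub>C (x + y) = c *\<^sub>C x + c *\<^sub>C y"
    by (simp add: scaleC_poly_mapping_def map_scaleC_add)
  show "(c + d) *\<^sub>C x = c *\<^sub>C x + d *\<^sub>C x" "c *\<^sub>C (d *\<^sub>C x) = (c * d) *\<^sub>C x" "1 *\<^sub>C x = x"
    by (intro poly_mapping_eqI;
        simp add: scaleC_poly_mapping_def lookup_map_scaleC lookup_add scaleC_add_left
          scaleC_scaleC scaleC_one)+
  show "(c *\<^sub>C x) * y = c *\<^sub>C (x * y)" "x * (c *\<^sub>C y) = c *\<^sub>C (x * y)"
    by (simp_all add: scaleC_poly_mapping_def map_scaleC_mult)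
qed
end

lemma lookup_scaleC [simp]:
  "Poly_Mapping.lookup (c *\<^sub>C p) k = c *\<^sub>C Poly_Mapping.lookup p k"
  by (simp add: scaleC_poly_mapping_def lookup_map_scaleC)

lemma scaleC_single [simp]:
  "c *\<^sub>C Poly_Mapping.single k x = Poly_Mapping.single k (c *\<^sub>C x)"
  by (simp add: scaleC_poly_mapping_def map_scaleC_single)

definition lin_ext :: "('k \<Rightarrow> 'a::complex_algebra_1) \<Rightarrow> ('k \<Rightarrow>\<^sub>0 complex) \<Rightarrow> 'a" where
  "lin_ext g p = (\<Sum>k\<in>Poly_Mapping.keys p. Poly_Mapping.lookup p k *\<^sub>C g k)"

lemma lin_ext_single [simp]: "lin_ext g (Poly_Mapping.single k c) = c *\<^sub>C g k"
  by (simp add: lin_ext_def)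

lemma lin_ext_zero [simp]: "lin_ext g 0 = 0"
  by (simp add: lin_ext_def)

lemma lin_ext_one [simp]: "lin_ext g 1 = g 0"
  by (simp add: lin_ext_def scaleC_one)

lemma lin_ext_add: "lin_ext g (p + q) = lin_ext g p + lin_ext g q"
  unfolding lin_ext_def
  by (rule setsum_keys_plus_distrib) (simp_all add: scaleC_add_left)

lemma clinear_lin_ext:
  fixes g :: "'k::monoid_add \<Rightarrow> 'a::complex_algebra_1"
  shows "clinear (lin_ext g)"
proof (rule clinearI)
  show "lin_ext g (p + q) = lin_ext g p + lin_ext g q" for p q by (rule lin_ext_add)
  show "lin_ext g (c *\<^sub>C p) = c *\<^sub>C lin_ext g p" for c p
    by (induction p rule: poly_mapping_induct_single)
       (simp_all add: lin_ext_add scaleC_add_right scaleC_scaleC scaleC_complex_def)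
qed

lemma lin_ext_mult:
  fixes g :: "'k::monoid_add \<Rightarrow> 'a::complex_algebra_1"
  assumes "\<And>k l. g (k + l) = g k * g l"
  shows "lin_ext g (p * q) = lin_ext g p * lin_ext g q"
proof -
  have s: "lin_ext g (Poly_Mapping.single k c * q) = (c *\<^sub>C g k) * lin_ext g q" for k c
    by (induction q rule: poly_mapping_induct_single)
       (simp_all add: mult_single assms lin_ext_add distrib_left scaleC_scaleC
          mult_scaleC_left mult_scaleC_right mult.commute)
  show ?thesis
    by (induction p rule: poly_mapping_induct_single)
       (simp_all add: s lin_ext_add distrib_right)
qed

inductive_set ideal_gen :: "'a::ring_1 set \<Rightarrow> 'a set" for R where
  zero: "0 \<in> ideal_gen R"
| gen: "r \<in> R \<Longrightarrow> x * r * y \<in> ideal_gen R"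
| add: "p \<in> ideal_gen R \<Longrightarrow> q \<in> ideal_gen R \<Longrightarrow> p + q \<in> ideal_gen R"

lemma ideal_mult_left: "p \<in> ideal_gen R \<Longrightarrow> x * p \<in> ideal_gen R"
proof (induction rule: ideal_gen.induct)
  case (gen r u v)
  then show ?case using ideal_gen.gen[of r R "x * u" v] by (simp add: mult.assoc)
qed (auto simp: distrib_left intro: ideal_gen.intros)

lemma ideal_mult_right: "p \<in> ideal_gen R \<Longrightarrow> p * x \<in> ideal_gen R"
proof (induction rule: ideal_gen.induct)
  case (gen r u v)
  then show ?case using ideal_gen.gen[of r R u "v * x"] by (simp add: mult.assoc)
qed (auto simp: distrib_right intro: ideal_gen.intros)

lemma ideal_minus: "p \<in> ideal_gen R \<Longrightarrow> - p \<in> ideal_gen R"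
  using ideal_mult_left[of p R "- 1"] by simp

lemma ideal_diff: "p \<in> ideal_gen R \<Longrightarrow> q \<in> ideal_gen R \<Longrightarrow> p - q \<in> ideal_gen R"
  using ideal_gen.add[of p R "- q"] ideal_minus[of q R] by simp

lemma ideal_scaleC: "p \<in> ideal_gen R \<Longrightarrow> c *\<^sub>C p \<in> ideal_gen R"
  for p :: "'a::complex_algebra_1"
  using ideal_mult_left[of p R "c *\<^sub>C 1"] by (simp add: mult_scaleC_left)

lemma ideal_cong_add:
  "p - p' \<in> ideal_gen R \<Longrightarrow> q - q' \<in> ideal_gen R \<Longrightarrow> (p + q) - (p' + q') \<in> ideal_gen R"
  using ideal_gen.add[of "p - p'" R "q - q'"] by (simp add: algebra_simps)

lemma ideal_cong_diff:
  "p - p' \<in> ideal_gen R \<Longrightarrow> q - q' \<in> ideal_gen R \<Longrightarrow> (p - q) - (p' - q') \<in> ideal_gen R"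
  using ideal_diff[of "p - p'" R "q - q'"] by (simp add: algebra_simps)

lemma ideal_cong_minus: "p - p' \<in> ideal_gen R \<Longrightarrow> (- p) - (- p') \<in> ideal_gen R"
  using ideal_minus[of "p - p'" R] by (simp add: algebra_simps)

lemma ideal_cong_mult:
  assumes "p - p' \<in> ideal_gen R" "q - q' \<in> ideal_gen R"
  shows "p * q - p' * q' \<in> ideal_gen R"
proof -
  have "p * q - p' * q' = (p - p') * q + p' * (q - q')" by (simp add: algebra_simps)
  then show ?thesis
    using ideal_gen.add[OF ideal_mult_right[OF assms(1)] ideal_mult_left[OF assms(2)]] by simp
qed

lemma ideal_cong_scaleC: "p - p' \<in> ideal_gen R \<Longrightarrow> c *\<^sub>C p - c *\<^sub>C p' \<in> ideal_gen R"
  for p :: "'a::complex_algebra_1"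
  using ideal_scaleC[of "p - p'" R c] by (simp add: cvs.scale_right_diff_distrib)

lemma equivp_ideal: "equivp (\<lambda>p q. p - q \<in> ideal_gen R)"
proof (rule equivpI)
  show "reflp (\<lambda>p q. p - q \<in> ideal_gen R)" by (auto intro!: reflpI ideal_gen.zero)
  show "symp (\<lambda>p q. p - q \<in> ideal_gen R)"
    by (rule sympI) (use ideal_minus in fastforce)
  show "transp (\<lambda>p q. p - q \<in> ideal_gen R)"
    by (rule transpI) (use ideal_gen.add in fastforce)
qed

lemma ideal_kernel_monomial:
  fixes L :: "('k::monoid_add \<Rightarrow>\<^sub>0 complex) \<Rightarrow> 'a::complex_algebra_1"
  assumes L: "clinear L"
    and mon: "\<And>r u v. r \<in> R \<Longrightarrow> L (Poly_Mapping.single u 1 * r * Poly_Mapping.single v 1) = 0"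
    and p: "p \<in> ideal_gen R"
  shows "L p = 0"
  using p
proof (induction rule: ideal_gen.induct)
  case (gen r x y)
  have c: "Poly_Mapping.single k c = c *\<^sub>C Poly_Mapping.single k 1" for k :: 'k and c
    by (simp add: scaleC_complex_def)
  have 1: "L (Poly_Mapping.single u 1 * r * y) = 0" for u
  proof (induction y rule: poly_mapping_induct_single)
    case (single v d)
    show ?case
      by (subst c) (simp only: mult_scaleC_right clinearD(2)[OF L] mon[OF gen] cvs.scale_zero_right)
  qed (simp_all add: distrib_left clinearD[OF L])
  show ?case
  proof (induction x rule: poly_mapping_induct_single)
    case (single u d)
    show ?case
      by (subst c) (simp only: mult_scaleC_left clinearD(2)[OF L] 1 cvs.scale_zero_right)
  qed (simp_all add: distrib_right clinearD[OF L])
qed (simp_all add: clinearD[OF L])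


section \<open>The algebra \<open>S03\<close>\<close>

datatype gen = GA | GB | GC | GD

datatype word = Word (letters: "gen list")

instantiation word :: monoid_add
begin
definition zero_word :: word where "zero_word = Word []"
definition plus_word :: "word \<Rightarrow> word \<Rightarrow> word" where
  "plus_word u v = Word (letters u @ letters v)"
instance by standard (simp_all add: zero_word_def plus_word_def)
end

lemma letters_simps [simp]: "letters 0 = []" "letters (u + v) = letters u @ letters v"
  by (simp_all add: zero_word_def plus_word_def)

text \<open>The free algebra: finitely supported functions on the free monoid, with convolution.\<close>

type_synonym free = "word \<Rightarrow>\<^sub>0 complex"

definition mon :: "gen list \<Rightarrow> free" where
  "mon w = Poly_Mapping.single (Word w) 1"

definition forbidden :: "(gen \<times> gen) set" where
  "forbidden = {(GB, GB), (GC, GC), (GA, GD), (GD, GA), (GA, GB), (GB, GD), (GD, GC), (GC, GA)}"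

definition relators :: "free set" where
  "relators = {mon [x] * mon [y] | x y. (x, y) \<in> forbidden}"

definition normal :: "gen list \<Rightarrow> bool" where
  "normal w \<longleftrightarrow> successively (\<lambda>x y. (x, y) \<notin> forbidden) w"

lemma mon_mult: "mon u * mon v = mon (u @ v)"
  by (simp add: mon_def mult_single plus_word_def)

lemma relatorsE:
  assumes "r \<in> relators"
  obtains x y where "(x, y) \<in> forbidden" "r = Poly_Mapping.single (Word [x, y]) 1"
  using assms by (auto simp: relators_def mon_mult) (auto simp: mon_def)

lemma not_normal: "(x, y) \<in> forbidden \<Longrightarrow> \<not> normal (u @ x # y # v)"
  by (auto simp: normal_def successively_append_iff)

definition word_functional_free :: "(gen list \<Rightarrow> complex) \<Rightarrow> free \<Rightarrow> complex" where
  "word_functional_free \<phi> = lin_ext (\<lambda>u. if normal (letters u) then \<phi> (letters u) else 0)"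

lemma word_functional_free_ideal:
  assumes "p \<in> ideal_gen relators"
  shows "word_functional_free \<phi> p = 0"
proof (rule ideal_kernel_monomial[OF _ _ assms])
  show "clinear (word_functional_free \<phi>)"
    unfolding word_functional_free_def by (rule clinear_lin_ext)
  show "word_functional_free \<phi> (Poly_Mapping.single u 1 * r * Poly_Mapping.single v 1) = 0"
    if "r \<in> relators" for r u v
    using that by (elim relatorsE) (simp add: word_functional_free_def mult_single not_normal)
qed

quotient_type S03 = free / "\<lambda>p q. p - q \<in> ideal_gen relators"
  by (rule equivp_ideal)

instantiation S03 :: complex_algebra_1
begin
lift_definition zero_S03 :: S03 is 0 .
lift_definition one_S03 :: S03 is 1 .
lift_definition plus_S03 :: "S03 \<Rightarrow> S03 \<Rightarrow> S03" is "(+)" by (rule ideal_cong_add)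
lift_definition minus_S03 :: "S03 \<Rightarrow> S03 \<Rightarrow> S03" is "(-)" by (rule ideal_cong_diff)
lift_definition uminus_S03 :: "S03 \<Rightarrow> S03" is uminus by (rule ideal_cong_minus)
lift_definition times_S03 :: "S03 \<Rightarrow> S03 \<Rightarrow> S03" is "(*)" by (rule ideal_cong_mult)
lift_definition scaleC_S03 :: "complex \<Rightarrow> S03 \<Rightarrow> S03" is scaleC by (rule ideal_cong_scaleC)
instance
proof
  show "(0::S03) \<noteq> 1"
  proof transfer
    have "word_functional_free (\<lambda>_. 1) (0 - 1) \<noteq> 0"
      unfolding word_functional_free_def
      by (simp add: clinearD[OF clinear_lin_ext] normal_def)
    then show "(0::free) - 1 \<notin> ideal_gen relators" using word_functional_free_ideal by blast
  qed
qed (transfer; simp add: algebra_simps ideal_gen.zero scaleC_add_right scaleC_add_left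
       scaleC_scaleC scaleC_one mult_scaleC_left mult_scaleC_right)+
end

lift_definition gen_elem :: "gen \<Rightarrow> S03" is "\<lambda>x. mon [x]" .

definition a\<^sub>S :: S03 where "a\<^sub>S = gen_elem GA"
definition b\<^sub>S :: S03 where "b\<^sub>S = gen_elem GB"
definition c\<^sub>S :: S03 where "c\<^sub>S = gen_elem GC"
definition d\<^sub>S :: S03 where "d\<^sub>S = gen_elem GD"

definition word_elem :: "gen list \<Rightarrow> S03" where
  "word_elem w = prod_list (map gen_elem w)"

lemma word_elem_abs: "word_elem w = abs_S03 (mon w)"
proof (induction w)
  case Nil
  then show ?case
    by (simp add: word_elem_def one_S03.abs_eq mon_def flip: zero_word_def)
next
  case (Cons x w)
  then show ?case
    by (simp add: word_elem_def gen_elem.abs_eq times_S03.abs_eq mon_mult)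
qed

lemma word_elem_not_normal:
  assumes "(x, y) \<in> forbidden"
  shows "word_elem (u @ x # y # v) = 0"
proof -
  have "mon u * (mon [x] * mon [y]) * mon v \<in> ideal_gen relators"
    using assms by (intro ideal_gen.gen) (auto simp: relators_def)
  then show ?thesis
    by (simp add: word_elem_abs mon_mult zero_S03_def S03.abs_eq_iff)
qed

lemma relations:
  "b\<^sub>S * b\<^sub>S = 0" "c\<^sub>S * c\<^sub>S = 0" "a\<^sub>S * d\<^sub>S = 0" "d\<^sub>S * a\<^sub>S = 0"
  "a\<^sub>S * b\<^sub>S = 0" "b\<^sub>S * d\<^sub>S = 0" "d\<^sub>S * c\<^sub>S = 0" "c\<^sub>S * a\<^sub>S = 0"
  using word_elem_not_normal[of _ _ "[]" "[]"]
  by (simp_all add: word_elem_def a\<^sub>S_def b\<^sub>S_def c\<^sub>S_def d\<^sub>S_def forbidden_def)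


section \<open>The tensor square of \<open>S03\<close>\<close>

text \<open>
  If \<open>S03 = F / I\<close> with \<open>F\<close> free, then \<open>S03 \<otimes> S03 = (F \<otimes> F) / (I \<otimes> F + F \<otimes> I)\<close>. Here \<open>F \<otimes> F\<close> is
  the algebra of the monoid of pairs of words, and \<open>I \<otimes> F + F \<otimes> I\<close> is the two-sided ideal
  generated by \<open>r \<otimes> 1\<close> and \<open>1 \<otimes> r\<close> for the relators \<open>r\<close>.
\<close>

type_synonym free2 = "word \<times> word \<Rightarrow>\<^sub>0 complex"

definition tensor_free :: "free \<Rightarrow> free \<Rightarrow> free2" where
  "tensor_free p q = lin_ext (\<lambda>u. lin_ext (\<lambda>v. Poly_Mapping.single (u, v) 1) q) p"

definition relators2 :: "free2 set" where
  "relators2 = (\<lambda>r. tensor_free r 1) ` relators \<union> tensor_free 1 ` relators"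

lemma tensor_free_single:
  "tensor_free (Poly_Mapping.single u c) (Poly_Mapping.single v d) = Poly_Mapping.single (u, v) (c * d)"
  by (simp add: tensor_free_def scaleC_complex_def)

lemma tensor_free_add:
  "tensor_free (p + p') q = tensor_free p q + tensor_free p' q"
  "tensor_free p (q + q') = tensor_free p q + tensor_free p q'"
proof -
  show "tensor_free (p + p') q = tensor_free p q + tensor_free p' q"
    by (simp add: tensor_free_def lin_ext_add)
  show "tensor_free p (q + q') = tensor_free p q + tensor_free p q'"
    by (simp add: tensor_free_def lin_ext_add lin_ext_def[of _ p] scaleC_add_right sum.distrib)
qed

lemma tensor_free_zero [simp]: "tensor_free 0 q = 0" "tensor_free p 0 = 0"
  using tensor_free_add(1)[of 0 0 q] tensor_free_add(2)[of p 0 0] by simp_all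

lemma tensor_free_diff:
  "tensor_free (p - p') q = tensor_free p q - tensor_free p' q"
  "tensor_free p (q - q') = tensor_free p q - tensor_free p q'"
  subgoal using tensor_free_add(1)[of "p - p'" p' q] by simp
  subgoal using tensor_free_add(2)[of p "q - q'" q'] by simp
  done

lemma tensor_free_scaleC:
  "tensor_free (c *\<^sub>C p) q = c *\<^sub>C tensor_free p q"
  "tensor_free p (c *\<^sub>C q) = c *\<^sub>C tensor_free p q"
proof -
  show "tensor_free (c *\<^sub>C p) q = c *\<^sub>C tensor_free p q"
    by (simp add: tensor_free_def clinearD[OF clinear_lin_ext])
  show "tensor_free p (c *\<^sub>C q) = c *\<^sub>C tensor_free p q"
    by (simp add: tensor_free_def clinearD[OF clinear_lin_ext] lin_ext_def[of _ p]
        cvs.scale_sum_right scaleC_scaleC mult.commute)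
qed

lemma tensor_free_mult:
  "tensor_free p q * tensor_free p' q' = tensor_free (p * p') (q * q')"
proof -
  have 1: "tensor_free (Poly_Mapping.single u c) (Poly_Mapping.single v d)
        * tensor_free (Poly_Mapping.single u' c') q'
      = tensor_free (Poly_Mapping.single u c * Poly_Mapping.single u' c')
          (Poly_Mapping.single v d * q')" for u c v d u' c'
    by (induction q' rule: poly_mapping_induct_single)
       (simp_all add: tensor_free_single mult_single tensor_free_add distrib_left mult_ac)
  have 2: "tensor_free (Poly_Mapping.single u c) (Poly_Mapping.single v d) * tensor_free p' q'
      = tensor_free (Poly_Mapping.single u c * p') (Poly_Mapping.single v d * q')" for u c v d
    by (induction p' rule: poly_mapping_induct_single)
       (simp_all add: 1 tensor_free_add distrib_left)
  have 3: "tensor_free (Poly_Mapping.single u c) q * tensor_free p' q'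
      = tensor_free (Poly_Mapping.single u c * p') (q * q')" for u c
    by (induction q rule: poly_mapping_induct_single)
       (simp_all add: 2 tensor_free_add distrib_right)
  show ?thesis
    by (induction p rule: poly_mapping_induct_single)
       (simp_all add: 3 tensor_free_add distrib_right)
qed

lemma tensor_free_ideal:
  "p \<in> ideal_gen relators \<Longrightarrow> tensor_free p q \<in> ideal_gen relators2"
  "p \<in> ideal_gen relators \<Longrightarrow> tensor_free q p \<in> ideal_gen relators2"
proof -
  assume "p \<in> ideal_gen relators"
  then show "tensor_free p q \<in> ideal_gen relators2"
  proof (induction rule: ideal_gen.induct)
    case (gen r x y)
    have "tensor_free x 1 * tensor_free r 1 * tensor_free y q \<in> ideal_gen relators2"
      using gen by (intro ideal_gen.gen) (auto simp: relators2_def)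
    then show ?case by (simp add: tensor_free_mult)
  qed (auto simp: tensor_free_add intro: ideal_gen.intros)
next
  assume "p \<in> ideal_gen relators"
  then show "tensor_free q p \<in> ideal_gen relators2"
  proof (induction rule: ideal_gen.induct)
    case (gen r x y)
    have "tensor_free 1 x * tensor_free 1 r * tensor_free q y \<in> ideal_gen relators2"
      using gen by (intro ideal_gen.gen) (auto simp: relators2_def)
    then show ?case by (simp add: tensor_free_mult)
  qed (auto simp: tensor_free_add intro: ideal_gen.intros)
qed

lemma relators2E:
  assumes "r \<in> relators2"
  obtains x y where "(x, y) \<in> forbidden" "r = Poly_Mapping.single (Word [x, y], 0) 1"
    | x y where "(x, y) \<in> forbidden" "r = Poly_Mapping.single (0, Word [x, y]) 1"
  using assms unfolding relators2_def
  by (auto elim!: relatorsE simp: tensor_free_single simp flip: single_one)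

quotient_type S03_tensor = free2 / "\<lambda>p q. p - q \<in> ideal_gen relators2"
  by (rule equivp_ideal)

instantiation S03_tensor :: complex_algebra_1
begin
lift_definition zero_S03_tensor :: S03_tensor is 0 .
lift_definition one_S03_tensor :: S03_tensor is 1 .
lift_definition plus_S03_tensor :: "S03_tensor \<Rightarrow> S03_tensor \<Rightarrow> S03_tensor" is "(+)"
  by (rule ideal_cong_add)
lift_definition minus_S03_tensor :: "S03_tensor \<Rightarrow> S03_tensor \<Rightarrow> S03_tensor" is "(-)"
  by (rule ideal_cong_diff)
lift_definition uminus_S03_tensor :: "S03_tensor \<Rightarrow> S03_tensor" is uminus
  by (rule ideal_cong_minus)
lift_definition times_S03_tensor :: "S03_tensor \<Rightarrow> S03_tensor \<Rightarrow> S03_tensor" is "(*)"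
  by (rule ideal_cong_mult)
lift_definition scaleC_S03_tensor :: "complex \<Rightarrow> S03_tensor \<Rightarrow> S03_tensor" is scaleC
  by (rule ideal_cong_scaleC)
instance
proof
  show "(0::S03_tensor) \<noteq> 1"
  proof transfer
    let ?g = "\<lambda>k :: word \<times> word. if normal (letters (fst k)) \<and> normal (letters (snd k))
      then 1 else 0 :: complex"
    have "lin_ext ?g p = 0" if "p \<in> ideal_gen relators2" for p
    proof (rule ideal_kernel_monomial[OF clinear_lin_ext _ that])
      show "lin_ext ?g (Poly_Mapping.single u 1 * r * Poly_Mapping.single v 1) = 0"
        if "r \<in> relators2" for r u v
        using that by (elim relators2E) (auto simp: mult_single not_normal)
    qed
    moreover have "lin_ext ?g (0 - 1) \<noteq> 0"
      by (simp add: clinearD[OF clinear_lin_ext] normal_def)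
    ultimately show "(0::free2) - 1 \<notin> ideal_gen relators2" by blast
  qed
qed (transfer; simp add: algebra_simps ideal_gen.zero scaleC_add_right scaleC_add_left
       scaleC_scaleC scaleC_one mult_scaleC_left mult_scaleC_right)+
end

lift_definition tensor :: "S03 \<Rightarrow> S03 \<Rightarrow> S03_tensor" (infixl "\<otimes>" 70) is tensor_free
proof -
  fix p p' q q' :: free
  assume "p - p' \<in> ideal_gen relators" "q - q' \<in> ideal_gen relators"
  then have "tensor_free (p - p') q + tensor_free p' (q - q') \<in> ideal_gen relators2"
    by (intro ideal_gen.add tensor_free_ideal)
  then show "tensor_free p q - tensor_free p' q' \<in> ideal_gen relators2"
    by (simp add: tensor_free_diff)
qed

lemma tensor_add:
  "(f + f') \<otimes> g = f \<otimes> g + f' \<otimes> g" "f \<otimes> (g + g') = f \<otimes> g + f \<otimes> g'"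
  by (transfer; simp add: tensor_free_add ideal_gen.zero)+

lemma tensor_scaleC:
  "(c *\<^sub>C f) \<otimes> g = c *\<^sub>C (f \<otimes> g)" "f \<otimes> (c *\<^sub>C g) = c *\<^sub>C (f \<otimes> g)"
  by (transfer; simp add: tensor_free_scaleC ideal_gen.zero)+

lemma tensor_mult: "(f \<otimes> g) * (f' \<otimes> g') = (f * f') \<otimes> (g * g')"
  by (transfer; simp add: tensor_free_mult ideal_gen.zero)

lemma tensor_zero [simp]: "0 \<otimes> g = 0" "f \<otimes> 0 = 0"
  by (transfer; simp add: ideal_gen.zero)+

lemma one_tensor_one: "1 \<otimes> 1 = 1"
  by (transfer; simp add: tensor_free_single ideal_gen.zero flip: single_one zero_prod_def)


section \<open>Coproduct and counit\<close>

definition hom_free :: "(gen \<Rightarrow> 'a::complex_algebra_1) \<Rightarrow> free \<Rightarrow> 'a" where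
  "hom_free g = lin_ext (\<lambda>u. prod_list (map g (letters u)))"

lemma hom_free_mult: "hom_free g (p * q) = hom_free g p * hom_free g q"
  unfolding hom_free_def by (rule lin_ext_mult) simp

lemma clinear_hom_free: "clinear (hom_free g)"
  unfolding hom_free_def by (rule clinear_lin_ext)

lemma hom_free_ideal:
  assumes "\<And>x y. (x, y) \<in> forbidden \<Longrightarrow> g x * g y = 0" and "p \<in> ideal_gen relators"
  shows "hom_free g p = 0"
  using assms(2)
proof (induction rule: ideal_gen.induct)
  case (gen r x y)
  from gen have "hom_free g r = 0"
    by (elim relatorsE) (simp add: hom_free_def assms(1))
  then show ?case by (simp add: hom_free_mult)
qed (simp_all add: clinearD[OF clinear_hom_free])

primrec coproduct_gen :: "gen \<Rightarrow> S03_tensor" where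
  "coproduct_gen GA = a\<^sub>S \<otimes> a\<^sub>S + b\<^sub>S \<otimes> b\<^sub>S - c\<^sub>S \<otimes> c\<^sub>S + d\<^sub>S \<otimes> d\<^sub>S"
| "coproduct_gen GB = a\<^sub>S \<otimes> b\<^sub>S + b\<^sub>S \<otimes> a\<^sub>S - c\<^sub>S \<otimes> d\<^sub>S + d\<^sub>S \<otimes> c\<^sub>S"
| "coproduct_gen GC = a\<^sub>S \<otimes> c\<^sub>S + c\<^sub>S \<otimes> a\<^sub>S - b\<^sub>S \<otimes> d\<^sub>S + d\<^sub>S \<otimes> b\<^sub>S"
| "coproduct_gen GD = a\<^sub>S \<otimes> d\<^sub>S + d\<^sub>S \<otimes> a\<^sub>S - b\<^sub>S \<otimes> c\<^sub>S + c\<^sub>S \<otimes> b\<^sub>S"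

primrec counit_gen :: "gen \<Rightarrow> complex" where
  "counit_gen GA = 1"
| "counit_gen GB = 0"
| "counit_gen GC = 0"
| "counit_gen GD = 0"

lemma coproduct_gen_forbidden:
  "(x, y) \<in> forbidden \<Longrightarrow> coproduct_gen x * coproduct_gen y = 0"
  by (auto simp: forbidden_def distrib_left distrib_right left_diff_distrib right_diff_distrib
      tensor_mult relations)

lift_definition coproduct :: "S03 \<Rightarrow> S03_tensor" is "hom_free coproduct_gen"
proof -
  fix p q :: free
  assume "p - q \<in> ideal_gen relators"
  then have "hom_free coproduct_gen (p - q) = 0"
    by (rule hom_free_ideal[rotated]) (rule coproduct_gen_forbidden)
  then show "hom_free coproduct_gen p = hom_free coproduct_gen q"
    by (simp add: clinearD[OF clinear_hom_free])
qed

lift_definition counit :: "S03 \<Rightarrow> complex" is "hom_free counit_gen"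
proof -
  fix p q :: free
  assume "p - q \<in> ideal_gen relators"
  then have "hom_free counit_gen (p - q) = 0"
    by (rule hom_free_ideal[rotated]) (auto simp: forbidden_def)
  then show "hom_free counit_gen p = hom_free counit_gen q"
    by (simp add: clinearD[OF clinear_hom_free])
qed

lemma coproduct_hom:
  "coproduct (f + g) = coproduct f + coproduct g" "coproduct (c *\<^sub>C f) = c *\<^sub>C coproduct f"
  "coproduct (f * g) = coproduct f * coproduct g" "coproduct 1 = 1"
  by (transfer; simp add: clinearD[OF clinear_hom_free] hom_free_mult)+
     (transfer; simp add: hom_free_def scaleC_one flip: single_one)

lemma coproduct_generators:
  "coproduct a\<^sub>S = a\<^sub>S \<otimes> a\<^sub>S + b\<^sub>S \<otimes> b\<^sub>S - c\<^sub>S \<otimes> c\<^sub>S + d\<^sub>S \<otimes> d\<^sub>S"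
  "coproduct b\<^sub>S = a\<^sub>S \<otimes> b\<^sub>S + b\<^sub>S \<otimes> a\<^sub>S - c\<^sub>S \<otimes> d\<^sub>S + d\<^sub>S \<otimes> c\<^sub>S"
  "coproduct c\<^sub>S = a\<^sub>S \<otimes> c\<^sub>S + c\<^sub>S \<otimes> a\<^sub>S - b\<^sub>S \<otimes> d\<^sub>S + d\<^sub>S \<otimes> b\<^sub>S"
  "coproduct d\<^sub>S = a\<^sub>S \<otimes> d\<^sub>S + d\<^sub>S \<otimes> a\<^sub>S - b\<^sub>S \<otimes> c\<^sub>S + c\<^sub>S \<otimes> b\<^sub>S"
proof -
  have "coproduct (gen_elem x) = coproduct_gen x" for x
    by (simp add: gen_elem.abs_eq coproduct.abs_eq mon_def hom_free_def scaleC_one)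
  then show
    "coproduct a\<^sub>S = a\<^sub>S \<otimes> a\<^sub>S + b\<^sub>S \<otimes> b\<^sub>S - c\<^sub>S \<otimes> c\<^sub>S + d\<^sub>S \<otimes> d\<^sub>S"
    "coproduct b\<^sub>S = a\<^sub>S \<otimes> b\<^sub>S + b\<^sub>S \<otimes> a\<^sub>S - c\<^sub>S \<otimes> d\<^sub>S + d\<^sub>S \<otimes> c\<^sub>S"
    "coproduct c\<^sub>S = a\<^sub>S \<otimes> c\<^sub>S + c\<^sub>S \<otimes> a\<^sub>S - b\<^sub>S \<otimes> d\<^sub>S + d\<^sub>S \<otimes> b\<^sub>S"
    "coproduct d\<^sub>S = a\<^sub>S \<otimes> d\<^sub>S + d\<^sub>S \<otimes> a\<^sub>S - b\<^sub>S \<otimes> c\<^sub>S + c\<^sub>S \<otimes> b\<^sub>S"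
    by (simp_all add: a\<^sub>S_def b\<^sub>S_def c\<^sub>S_def d\<^sub>S_def)
qed


section \<open>The dual bialgebra \<open>s03\<close>\<close>

typedef S03_dual = "{Z :: S03 \<Rightarrow> complex. clinear Z}"
  morphisms pairing Abs_S03_dual
  by (rule exI[of _ "\<lambda>_. 0"]) (auto intro!: clinearI)

setup_lifting type_definition_S03_dual

lemma clinear_pairing: "clinear (pairing Z)"
  using pairing[of Z] by simp

text \<open>\<open>contract_right Z\<close> is \<open>id \<otimes> Z\<close>, with \<open>S03 \<otimes> \<complex>\<close> identified with \<open>S03\<close>.\<close>

lift_definition contract_right :: "S03_dual \<Rightarrow> S03_tensor \<Rightarrow> S03" is
  "\<lambda>Z. lin_ext (\<lambda>(u, v). pairing Z (word_elem (letters v)) *\<^sub>C word_elem (letters u))"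
proof -
  fix Z :: S03_dual and p q :: free2
  let ?L = "lin_ext (\<lambda>(u, v). pairing Z (word_elem (letters v)) *\<^sub>C word_elem (letters u))"
  assume pq: "p - q \<in> ideal_gen relators2"
  have "?L (p - q) = 0"
  proof (rule ideal_kernel_monomial[OF clinear_lin_ext _ pq])
    show "?L (Poly_Mapping.single u 1 * r * Poly_Mapping.single v 1) = 0"
      if "r \<in> relators2" for r u v
      using that
      by (elim relators2E; cases u; cases v)
         (auto simp: mult_single word_elem_not_normal clinearD[OF clinear_pairing])
  qed
  then show "?L p = ?L q" by (simp add: clinearD[OF clinear_lin_ext])
qed

lemma clinear_contract_right: "clinear (contract_right Z)"
  by (rule clinearI; transfer; simp add: clinearD[OF clinear_lin_ext])

lemma contract_right_tensor: "contract_right Z (f \<otimes> g) = pairing Z g *\<^sub>C f"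
proof -
  let ?L = "lin_ext (\<lambda>(u, v). pairing Z (word_elem (letters v)) *\<^sub>C word_elem (letters u))"
  have abs: "abs_S03 0 = 0" "abs_S03 (p + q) = abs_S03 p + abs_S03 q"
    "abs_S03 (Poly_Mapping.single u c) = c *\<^sub>C word_elem (letters u)" for p q u c
    by (simp_all add: zero_S03_def plus_S03.abs_eq word_elem_abs scaleC_S03.abs_eq mon_def
        scaleC_complex_def)
  have 1: "?L (tensor_free (Poly_Mapping.single u c) q)
      = pairing Z (abs_S03 q) *\<^sub>C c *\<^sub>C word_elem (letters u)" for u c q
    by (induction q rule: poly_mapping_induct_single)
       (simp_all add: tensor_free_single tensor_free_add lin_ext_add abs
          clinearD[OF clinear_pairing] scaleC_add_left scaleC_scaleC scaleC_complex_def mult_ac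
          distrib_left)
  have 2: "?L (tensor_free p q) = pairing Z (abs_S03 q) *\<^sub>C abs_S03 p" for p q
    by (induction p rule: poly_mapping_induct_single)
       (simp_all add: 1 tensor_free_add lin_ext_add abs scaleC_add_right)
  obtain p q where "f = abs_S03 p" "g = abs_S03 q"
    by (metis Quotient3_S03 Quotient3_abs_rep)
  then show ?thesis by (simp add: tensor.abs_eq contract_right.abs_eq 2)
qed

definition pairing2 :: "S03_dual \<Rightarrow> S03_dual \<Rightarrow> S03_tensor \<Rightarrow> complex" where
  "pairing2 u v t = pairing u (contract_right v t)"

lemma pairing2_tensor: "pairing2 u v (f \<otimes> g) = pairing u f * pairing v g"
  by (simp add: pairing2_def contract_right_tensor clinearD[OF clinear_pairing] scaleC_complex_def)

instantiation S03_dual :: "{plus, times, one}"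
begin
lift_definition plus_S03_dual :: "S03_dual \<Rightarrow> S03_dual \<Rightarrow> S03_dual" is "\<lambda>u v f. u f + v f"
  by (auto intro!: clinearI simp: clinearD scaleC_add_right algebra_simps)
lift_definition times_S03_dual :: "S03_dual \<Rightarrow> S03_dual \<Rightarrow> S03_dual" is
  "\<lambda>u v f. pairing2 u v (coproduct f)"
  by (auto intro!: clinearI
      simp: pairing2_def coproduct_hom clinearD[OF clinear_contract_right] clinearD[OF clinear_pairing])
lift_definition one_S03_dual :: S03_dual is counit
  by (auto intro!: clinearI) (transfer; simp add: clinearD[OF clinear_hom_free])+
instance ..
end

lift_definition scale_dual :: "complex \<Rightarrow> S03_dual \<Rightarrow> S03_dual" is "\<lambda>c u f. c * u f"
  by (auto intro!: clinearI simp: clinearD scaleC_complex_def algebra_simps)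

text \<open>The linear functional with prescribed values \<open>\<phi> w\<close> on the basis words \<open>w\<close>.\<close>

lift_definition word_functional_fun :: "(gen list \<Rightarrow> complex) \<Rightarrow> S03 \<Rightarrow> complex" is
  word_functional_free
proof -
  fix \<phi> and p q :: free
  assume "p - q \<in> ideal_gen relators"
  then have "word_functional_free \<phi> (p - q) = 0" by (rule word_functional_free_ideal)
  then show "word_functional_free \<phi> p = word_functional_free \<phi> q"
    by (simp add: word_functional_free_def clinearD[OF clinear_lin_ext])
qed

lift_definition word_functional :: "(gen list \<Rightarrow> complex) \<Rightarrow> S03_dual" is word_functional_fun
  by (auto intro!: clinearI)
     (transfer; simp add: word_functional_free_def clinearD[OF clinear_lin_ext])+

lemma pairing_word_functional:
  "normal w \<Longrightarrow> pairing (word_functional \<phi>) (word_elem w) = \<phi> w"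
  by (simp add: word_functional.rep_eq word_elem_abs word_functional_fun.abs_eq
      word_functional_free_def mon_def scaleC_complex_def)

lemma basis_words:
  "inj_on word_elem {w. normal w}"
  "cvs.independent (word_elem ` {w. normal w})"
  "cvs.span (word_elem ` {w. normal w}) = UNIV"
proof -
  define \<psi> where "\<psi> w = word_functional (\<lambda>u. if u = w then 1 else 0)" for w
  have \<psi>: "pairing (\<psi> w) (word_elem u) = (if u = w then 1 else 0)" if "normal u" for u w
    using that by (simp add: \<psi>_def pairing_word_functional)
  show inj: "inj_on word_elem {w. normal w}"
    by (rule inj_onI) (metis \<psi> mem_Collect_eq zero_neq_one)
  show "cvs.independent (word_elem ` {w. normal w})"
    unfolding cvs.dependent_def
  proof (clarsimp)
    fix w
    assume w: "normal w" "word_elem w \<in> cvs.span (word_elem ` {w. normal w} - {word_elem w})"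
    from w(2) have "pairing (\<psi> w) (word_elem w) = 0"
    proof (induction rule: cvs.span_induct_alt)
      case base
      show ?case by (simp add: clinearD[OF clinear_pairing])
    next
      case (step c x y)
      then have "pairing (\<psi> w) x = 0" using \<psi> by auto
      with step show ?case by (simp add: clinearD[OF clinear_pairing])
    qed
    with \<psi>[OF w(1)] show False by simp
  qed
  have word: "word_elem w \<in> cvs.span (word_elem ` {w. normal w})" for w
  proof (cases "normal w")
    case True
    then show ?thesis by (intro cvs.span_base) auto
  next
    case False
    then obtain x y u v where "(x, y) \<in> forbidden" "w = u @ x # y # v"
      unfolding normal_def
    proof (induction w arbitrary: thesis rule: induct_list012)
      case (3 x y w)
      show ?case
      proof (cases "(x, y) \<in> forbidden")
        case True
        then show ?thesis using 3(3)[of x y "[]" w] by simp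
      next
        case False
        with 3(4) have n: "\<not> successively (\<lambda>x y. (x, y) \<notin> forbidden) (y # w)" by simp
        show ?thesis
        proof (rule 3(2)[OF _ n])
          fix x' y' u v
          assume "(x', y') \<in> forbidden" "y # w = u @ x' # y' # v"
          then show ?thesis using 3(3)[of x' y' "x # u" v] by simp
        qed
      qed
    qed simp_all
    then show ?thesis by (simp add: word_elem_not_normal cvs.span_zero)
  qed
  have "abs_S03 p \<in> cvs.span (word_elem ` {w. normal w})" for p
  proof (induction p rule: poly_mapping_induct_single)
    case zero
    show ?case by (metis cvs.span_zero zero_S03_def)
  next
    case (single k c)
    have "abs_S03 (Poly_Mapping.single k c) = c *\<^sub>C word_elem (letters k)"
      by (simp add: word_elem_abs scaleC_S03.abs_eq mon_def scaleC_complex_def)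
    then show ?case by (simp add: word cvs.span_scale)
  next
    case (add p q)
    then show ?case using cvs.span_add by (fastforce simp flip: plus_S03.abs_eq)
  qed
  moreover have "\<exists>p. f = abs_S03 p" for f
    by (metis Quotient3_S03 Quotient3_abs_rep)
  ultimately show "cvs.span (word_elem ` {w. normal w}) = UNIV" by (metis UNIV_eq_I)
qed

definition A\<^sub>S :: S03_dual where
  "A\<^sub>S = word_functional (\<lambda>w. if w = replicate (length w) GA then of_nat (length w) else 0)"
definition B\<^sub>S :: S03_dual where
  "B\<^sub>S = word_functional (\<lambda>w. if \<exists>k. w = GB # replicate k GA then 1 else 0)"
definition C\<^sub>S :: S03_dual where
  "C\<^sub>S = word_functional (\<lambda>w. if \<exists>k. w = replicate k GA @ [GC] then 1 else 0)"
definition D\<^sub>S :: S03_dual where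
  "D\<^sub>S = word_functional (\<lambda>w. if w = [GD] then 1 else 0)"

inductive_set s03 :: "S03_dual set" where
  one: "1 \<in> s03"
| A: "A\<^sub>S \<in> s03"
| B: "B\<^sub>S \<in> s03"
| C: "C\<^sub>S \<in> s03"
| D: "D\<^sub>S \<in> s03"
| add: "u \<in> s03 \<Longrightarrow> v \<in> s03 \<Longrightarrow> u + v \<in> s03"
| scale: "u \<in> s03 \<Longrightarrow> scale_dual c u \<in> s03"
| mult: "u \<in> s03 \<Longrightarrow> v \<in> s03 \<Longrightarrow> u * v \<in> s03"


section \<open>The right regular action and its subrepresentations\<close>

definition \<pi>\<^sub>R :: "S03_dual \<Rightarrow> S03 \<Rightarrow> S03" where
  "\<pi>\<^sub>R Z f = contract_right Z (coproduct f)"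

definition W :: "nat \<Rightarrow> S03 set" where
  "W N = cvs.span {word_elem w | w. normal w \<and> length w = N}"

definition subrep :: "S03 set \<Rightarrow> bool" where
  "subrep U \<longleftrightarrow> cvs.subspace U \<and> (\<forall>Z\<in>s03. \<forall>f\<in>U. \<pi>\<^sub>R Z f \<in> U)"

definition irreducible_rep :: "S03 set \<Rightarrow> bool" where
  "irreducible_rep U \<longleftrightarrow>
     subrep U \<and> U \<noteq> {0} \<and> (\<forall>V. subrep V \<and> V \<subseteq> U \<longrightarrow> V = {0} \<or> V = U)"

definition isomorphic_rep :: "S03 set \<Rightarrow> S03 set \<Rightarrow> bool" where
  "isomorphic_rep U V \<longleftrightarrow>
     (\<exists>\<phi>. bij_betw \<phi> U V \<and>
        (\<forall>f\<in>U. \<forall>g\<in>U. \<phi> (f + g) = \<phi> f + \<phi> g) \<and>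
        (\<forall>c. \<forall>f\<in>U. \<phi> (c *\<^sub>C f) = c *\<^sub>C \<phi> f) \<and>
        (\<forall>Z\<in>s03. \<forall>f\<in>U. \<phi> (\<pi>\<^sub>R Z f) = \<pi>\<^sub>R Z (\<phi> f)))"

definition direct_sum :: "'i set \<Rightarrow> ('i \<Rightarrow> S03 set) \<Rightarrow> S03 set \<Rightarrow> bool" where
  "direct_sum I U V \<longleftrightarrow>
     finite I \<and> (\<forall>i\<in>I. cvs.subspace (U i)) \<and>
     V = {\<Sum>i\<in>I. u i | u. \<forall>i\<in>I. u i \<in> U i} \<and>
     (\<forall>u. (\<forall>i\<in>I. u i \<in> U i) \<and> (\<Sum>i\<in>I. u i) = 0 \<longrightarrow> (\<forall>i\<in>I. u i = 0))"

definition acts_as :: "S03_dual \<Rightarrow> complex \<Rightarrow> S03 set \<Rightarrow> bool" where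
  "acts_as Z c U \<longleftrightarrow> (\<forall>f\<in>U. \<pi>\<^sub>R Z f = c *\<^sub>C f)"

text \<open>\<open>\<epsilon>\<close> and \<open>\<epsilon>'\<close> are the signs: \<open>C\<^sub>S\<close> acts as \<open>\<i> * \<epsilon>'\<close>.\<close>

definition has_character :: "S03 set \<Rightarrow> complex \<Rightarrow> complex \<Rightarrow> bool" where
  "has_character U \<epsilon> \<epsilon>' \<longleftrightarrow> acts_as B\<^sub>S \<epsilon> U \<and> acts_as C\<^sub>S (\<i> * \<epsilon>') U \<and> acts_as D\<^sub>S 0 U"

definition one_dim_rep :: "S03 set \<Rightarrow> complex \<Rightarrow> complex \<Rightarrow> bool" where
  "one_dim_rep U \<epsilon> \<epsilon>' \<longleftrightarrow> subrep U \<and> cvs.dim U = 1 \<and> has_character U \<epsilon> \<epsilon>'"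

definition signs :: "complex set" where
  "signs = {1, -1}"

definition irreps_in :: "nat \<Rightarrow> S03 set set" where
  "irreps_in N = {U. irreducible_rep U \<and> U \<subseteq> W N}"

definition iso_rel :: "nat \<Rightarrow> (S03 set \<times> S03 set) set" where
  "iso_rel N = {(U, V). U \<in> irreps_in N \<and> V \<in> irreps_in N \<and> isomorphic_rep U V}"


section \<open>The vectors of the decomposition\<close>

definition w1_even :: "nat \<Rightarrow> S03" where
  "w1_even k = (if k = 1 then a\<^sub>S + d\<^sub>S else b\<^sub>S - c\<^sub>S)"

definition w1_odd :: "nat \<Rightarrow> S03" where
  "w1_odd k = (if k = 1 then b\<^sub>S + c\<^sub>S else a\<^sub>S - d\<^sub>S)"

definition w2 :: "nat \<times> complex \<times> complex \<Rightarrow> S03" where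
  "w2 = (\<lambda>(k, \<epsilon>, \<epsilon>').
     if k = 1 then (a\<^sub>S + \<epsilon> *\<^sub>C b\<^sub>S) * (a\<^sub>S + (\<i> * \<epsilon>') *\<^sub>C c\<^sub>S)
     else (d\<^sub>S + \<epsilon> *\<^sub>C c\<^sub>S) * (d\<^sub>S + (\<i> * \<epsilon>') *\<^sub>C b\<^sub>S))"

datatype form = AA | DD | AD | DA

fun wN :: "form \<times> complex \<times> complex \<times> gen list \<Rightarrow> S03" where
  "wN (AA, \<epsilon>, \<epsilon>', f) = (a\<^sub>S + \<epsilon> *\<^sub>C b\<^sub>S) * word_elem f * (a\<^sub>S + (\<i> * \<epsilon>') *\<^sub>C c\<^sub>S)"
| "wN (DD, \<epsilon>, \<epsilon>', f) = (d\<^sub>S + \<epsilon> *\<^sub>C c\<^sub>S) * word_elem f * (d\<^sub>S + (\<i> * \<epsilon>') *\<^sub>C b\<^sub>S)"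
| "wN (AD, \<epsilon>, \<epsilon>', f) = (a\<^sub>S + \<epsilon> *\<^sub>C b\<^sub>S) * word_elem f * (d\<^sub>S + (\<i> * \<epsilon>') *\<^sub>C b\<^sub>S)"
| "wN (DA, \<epsilon>, \<epsilon>', f) = (d\<^sub>S + \<epsilon> *\<^sub>C c\<^sub>S) * word_elem f * (a\<^sub>S + (\<i> * \<epsilon>') *\<^sub>C c\<^sub>S)"

definition wN_index :: "nat \<Rightarrow> (form \<times> complex \<times> complex \<times> gen list) set" where
  "wN_index N = {(j, \<epsilon>, \<epsilon>', f). \<epsilon> \<in> signs \<and> \<epsilon>' \<in> signs \<and>
     normal f \<and> length f = N - 2 \<and> wN (j, \<epsilon>, \<epsilon>', f) \<noteq> 0}"

end

theory Submission
  imports Defs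
begin

text \<open>
  Contracting the second factor of \<open>\<delta>(f)\<close> with \<open>B\<^sub>S\<close> (resp. \<open>C\<^sub>S\<close>) only sees the words \<open>b a\<^sup>k\<close>
  (resp. \<open>a\<^sup>k c\<close>), so \<open>B\<^sub>S\<close> acts on a word through its first letter, \<open>C\<^sub>S\<close> through its last letter,
  \<open>D\<^sub>S\<close> kills all words of length other than \<open>1\<close>, and \<open>A\<^sub>S\<close> counts letters. Hence on \<open>W N\<close> with
  \<open>N \<ge> 2\<close> the operators \<open>B\<^sub>S\<close> and \<open>C\<^sub>S\<close> commute and satisfy \<open>B\<^sub>S\<^sup>2 = 1\<close>, \<open>C\<^sub>S\<^sup>2 = -1\<close>: they are
  simultaneously diagonalisable with spectral projections \<open>(1 + \<epsilon> B\<^sub>S)(1 - \<i> \<epsilon>' C\<^sub>S) / 4\<close>. The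
  vectors \<open>wN\<close> are, up to scalars, the images of basis words under these projections, and by
  coassociativity a joint eigenvector of the generators spans a subrepresentation.
\<close>

section \<open>The right regular action\<close>

text \<open>The relations fit the action: \<open>a\<close> and \<open>b\<close> exclude the same
  successors, as do \<open>c\<close> and \<open>d\<close>, so the change of first letter made by
  \<open>B\<^sub>S\<close> carries basis words to basis words. The same holds for
  \<open>C\<^sub>S\<close>, the last letter and predecessors. In degree at least two, the four forms
  of \<open>wN\<close> select one word from each orbit of these changes. In degree one the first
  letter is also the last. There \<open>B\<^sub>S\<close> and \<open>C\<^sub>S\<close> anticommute,
  and \<open>D\<^sub>S\<close> acts as \<open>B\<^sub>S\<close> followed by
  \<open>C\<^sub>S\<close>, which is why the irreducible pieces are two-dimensional. The coproduct
  of a word is never expanded. A letter is moved into the functional instead: \<open>Z\<close>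
  evaluated on \<open>x * f\<close> is a functional of \<open>f\<close>, and multiplicativity of the
  coproduct turns this into a recursion for the action. Linear independence of the \<open>wN\<close>
  comes from dual functionals: project, then read one coefficient.\<close>

lemma tensor_induct [case_names word add]:
  assumes "\<And>c u v. P (c *\<^sub>C (word_elem u \<otimes> word_elem v))"
    and "\<And>s t. P s \<Longrightarrow> P t \<Longrightarrow> P (s + t)"
  shows "P (t :: S03_tensor)"
proof -
  have abs_single: "abs_S03_tensor (Poly_Mapping.single (u, v) c)
      = c *\<^sub>C (word_elem (letters u) \<otimes> word_elem (letters v))" for u v c
    unfolding word_elem_abs tensor.abs_eq scaleC_S03_tensor.abs_eq mon_def tensor_free_single
      scaleC_single scaleC_complex_def by simp
  have "P (abs_S03_tensor p)" for p
  proof (induction p rule: poly_mapping_induct_single)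
    case zero
    \<comment> \<open>Zero is a word tensor with coefficient \<open>0\<close>, so the rule has no
      separate zero case.\<close>
    show ?case using assms(1)[of 0 "[]" "[]"] by (simp add: zero_S03_tensor_def)
  next
    case (single k c)
    then show ?case by (cases k) (simp only: abs_single assms(1))
  next
    case (add p q)
    then show ?case unfolding plus_S03_tensor.abs_eq[symmetric] by (rule assms(2))
  qed
  from this[of "rep_S03_tensor t"] show ?thesis
    by (simp only: Quotient3_abs_rep[OF Quotient3_S03_tensor])
qed

lemma S03_induct [case_names zero word add]:
  assumes "P 0" and "\<And>c w f. P f \<Longrightarrow> P (c *\<^sub>C word_elem w + f)"
  shows "P (f :: S03)"
proof -
  have "f \<in> cvs.span (word_elem ` {w. normal w})" by (simp add: basis_words(3))
  then show ?thesis
  proof (induction rule: cvs.span_induct_alt)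
    case base
    show ?case by (rule assms(1))
  next
    case (step c x y)
    then show ?case using assms(2)[of y c] by fastforce
  qed
qed

text \<open>The hypothesis ranges over all words, so it can be proved by list induction without
  tracking normality; a word that is not normal is \<open>0\<close>.\<close>

lemma linear_eq_on_words:
  assumes "clinear F" "clinear G" "\<And>w. F (word_elem w) = G (word_elem w)"
  shows "F (f :: S03) = G f"
  by (induction f rule: S03_induct) (simp_all add: clinearD[OF assms(1)] clinearD[OF assms(2)] assms(3))

lemma dual_eqI:
  assumes "\<And>w. pairing Y (word_elem w) = pairing Z (word_elem w)"
  shows "Y = Z"
proof -
  have "pairing Y = pairing Z"
    by (rule ext) (rule linear_eq_on_words[OF clinear_pairing clinear_pairing assms])
  then show ?thesis by (simp add: pairing_inject)
qed

lemma word_elem_eq_0: "\<not> normal w \<Longrightarrow> word_elem w = 0"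
proof (induction w rule: induct_list012)
  case (3 x y w)
  show ?case
  proof (cases "(x, y) \<in> forbidden")
    case True
    then show ?thesis using word_elem_not_normal[of x y "[]" w] by simp
  next
    case False
    with 3 show ?thesis by (simp add: normal_def word_elem_def)
  qed
qed (simp_all add: normal_def)

lemma pairing_word_functional_if:
  "pairing (word_functional \<phi>) (word_elem w) = (if normal w then \<phi> w else 0)"
  by (simp add: pairing_word_functional word_elem_eq_0 clinearD[OF clinear_pairing])

lemma word_elem_simps [simp]:
  "word_elem [] = 1" "word_elem (x # w) = gen_elem x * word_elem w"
  "word_elem (v @ w) = word_elem v * word_elem w"
  by (simp_all add: word_elem_def)

section \<open>Translates of functionals and the action on products\<close>

definition lshift :: "S03 \<Rightarrow> S03_dual \<Rightarrow> S03_dual" where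
  "lshift g Z = Abs_S03_dual (\<lambda>f. pairing Z (g * f))"

definition rshift :: "S03 \<Rightarrow> S03_dual \<Rightarrow> S03_dual" where
  "rshift g Z = Abs_S03_dual (\<lambda>f. pairing Z (f * g))"

lemma pairing_shift:
  "pairing (lshift g Z) f = pairing Z (g * f)" "pairing (rshift g Z) f = pairing Z (f * g)"
proof -
  have "clinear (\<lambda>f. pairing Z (g * f))" "clinear (\<lambda>f. pairing Z (f * g))"
    by (rule clinearI;
        simp add: clinearD[OF clinear_pairing] distrib_left distrib_right mult_scaleC_left
          mult_scaleC_right)+
  then show "pairing (lshift g Z) f = pairing Z (g * f)" "pairing (rshift g Z) f = pairing Z (f * g)"
    by (simp_all add: lshift_def rshift_def Abs_S03_dual_inverse)
qed

text \<open>A pure tensor multiplied onto \<open>t\<close> moves its second factor into the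
  functional, as a translate. With the coproduct of a letter in its place, the action on a word
  becomes a recursion over the letters, from either end.\<close>

lemma contract_right_mult:
  "contract_right Z ((f \<otimes> g) * t) = f * contract_right (lshift g Z) t"
  "contract_right Z (t * (f \<otimes> g)) = contract_right (rshift g Z) t * f"
  by (induction t rule: tensor_induct)
     (simp_all add: distrib_left distrib_right clinearD[OF clinear_contract_right] tensor_mult
       contract_right_tensor pairing_shift mult_scaleC_right mult_scaleC_left)

lemma contract_right_dual:
  "contract_right (Y + Z) t = contract_right Y t + contract_right Z t"
  "contract_right (scale_dual c Z) t = c *\<^sub>C contract_right Z t"
  by (induction t rule: tensor_induct)
     (simp_all add: clinearD[OF clinear_contract_right] contract_right_tensor plus_S03_dual.rep_eq
       scale_dual.rep_eq scaleC_add_left scaleC_add_right scaleC_scaleC mult_ac)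

lemma clinear_action: "clinear (\<pi>\<^sub>R Z)"
  unfolding \<pi>\<^sub>R_def
  by (rule clinearI) (simp_all add: coproduct_hom clinearD[OF clinear_contract_right])

lemmas action_linear = clinearD[OF clinear_action]

lemma action_dual:
  "\<pi>\<^sub>R (Y + Z) f = \<pi>\<^sub>R Y f + \<pi>\<^sub>R Z f" "\<pi>\<^sub>R (scale_dual c Z) f = c *\<^sub>C \<pi>\<^sub>R Z f"
  by (simp_all add: \<pi>\<^sub>R_def contract_right_dual)

lemma action_one: "\<pi>\<^sub>R Z 1 = pairing Z 1 *\<^sub>C 1"
  by (simp add: \<pi>\<^sub>R_def coproduct_hom contract_right_tensor flip: one_tensor_one)

lemma pairing_times: "pairing (Y * Z) f = pairing Y (\<pi>\<^sub>R Z f)"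
  by (simp add: times_S03_dual.rep_eq pairing2_def \<pi>\<^sub>R_def)

lemma action_gen_mult:
  "\<pi>\<^sub>R Z (a\<^sub>S * f) = a\<^sub>S * \<pi>\<^sub>R (lshift a\<^sub>S Z) f + b\<^sub>S * \<pi>\<^sub>R (lshift b\<^sub>S Z) f
     - c\<^sub>S * \<pi>\<^sub>R (lshift c\<^sub>S Z) f + d\<^sub>S * \<pi>\<^sub>R (lshift d\<^sub>S Z) f"
  "\<pi>\<^sub>R Z (b\<^sub>S * f) = a\<^sub>S * \<pi>\<^sub>R (lshift b\<^sub>S Z) f + b\<^sub>S * \<pi>\<^sub>R (lshift a\<^sub>S Z) f
     - c\<^sub>S * \<pi>\<^sub>R (lshift d\<^sub>S Z) f + d\<^sub>S * \<pi>\<^sub>R (lshift c\<^sub>S Z) f"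
  "\<pi>\<^sub>R Z (c\<^sub>S * f) = a\<^sub>S * \<pi>\<^sub>R (lshift c\<^sub>S Z) f + c\<^sub>S * \<pi>\<^sub>R (lshift a\<^sub>S Z) f
     - b\<^sub>S * \<pi>\<^sub>R (lshift d\<^sub>S Z) f + d\<^sub>S * \<pi>\<^sub>R (lshift b\<^sub>S Z) f"
  "\<pi>\<^sub>R Z (d\<^sub>S * f) = a\<^sub>S * \<pi>\<^sub>R (lshift d\<^sub>S Z) f + d\<^sub>S * \<pi>\<^sub>R (lshift a\<^sub>S Z) f
     - b\<^sub>S * \<pi>\<^sub>R (lshift c\<^sub>S Z) f + c\<^sub>S * \<pi>\<^sub>R (lshift b\<^sub>S Z) f"
  by (simp_all add: \<pi>\<^sub>R_def coproduct_hom coproduct_generators distrib_right left_diff_distrib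
      clinearD[OF clinear_contract_right] contract_right_mult)

lemma action_mult_gen:
  "\<pi>\<^sub>R Z (f * a\<^sub>S) = \<pi>\<^sub>R (rshift a\<^sub>S Z) f * a\<^sub>S + \<pi>\<^sub>R (rshift b\<^sub>S Z) f * b\<^sub>S
     - \<pi>\<^sub>R (rshift c\<^sub>S Z) f * c\<^sub>S + \<pi>\<^sub>R (rshift d\<^sub>S Z) f * d\<^sub>S"
  "\<pi>\<^sub>R Z (f * b\<^sub>S) = \<pi>\<^sub>R (rshift b\<^sub>S Z) f * a\<^sub>S + \<pi>\<^sub>R (rshift a\<^sub>S Z) f * b\<^sub>S
     - \<pi>\<^sub>R (rshift d\<^sub>S Z) f * c\<^sub>S + \<pi>\<^sub>R (rshift c\<^sub>S Z) f * d\<^sub>S"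
  "\<pi>\<^sub>R Z (f * c\<^sub>S) = \<pi>\<^sub>R (rshift c\<^sub>S Z) f * a\<^sub>S + \<pi>\<^sub>R (rshift a\<^sub>S Z) f * c\<^sub>S
     - \<pi>\<^sub>R (rshift d\<^sub>S Z) f * b\<^sub>S + \<pi>\<^sub>R (rshift b\<^sub>S Z) f * d\<^sub>S"
  "\<pi>\<^sub>R Z (f * d\<^sub>S) = \<pi>\<^sub>R (rshift d\<^sub>S Z) f * a\<^sub>S + \<pi>\<^sub>R (rshift a\<^sub>S Z) f * d\<^sub>S
     - \<pi>\<^sub>R (rshift c\<^sub>S Z) f * b\<^sub>S + \<pi>\<^sub>R (rshift b\<^sub>S Z) f * c\<^sub>S"
  by (simp_all add: \<pi>\<^sub>R_def coproduct_hom coproduct_generators distrib_left right_diff_distrib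
      clinearD[OF clinear_contract_right] contract_right_mult)

lemma gen_elem_simps: "gen_elem GA = a\<^sub>S" "gen_elem GB = b\<^sub>S" "gen_elem GC = c\<^sub>S" "gen_elem GD = d\<^sub>S"
  by (simp_all add: a\<^sub>S_def b\<^sub>S_def c\<^sub>S_def d\<^sub>S_def)

abbreviation neg_dual :: "S03_dual \<Rightarrow> S03_dual" where
  "neg_dual \<equiv> scale_dual (- 1)"

text \<open>Multiplicativity of the coproduct, read on functionals: translating a convolution
  product by a letter splits along the coproduct of that letter. The minus sign is a scaling, since
  \<open>S03_dual\<close> is equipped with \<open>+\<close>, \<open>*\<close>, \<open>1\<close> and
  \<open>scale_dual\<close> only.\<close>

lemma lshift_times:
  "lshift a\<^sub>S (Y * Z) = lshift a\<^sub>S Y * lshift a\<^sub>S Z + lshift b\<^sub>S Y * lshift b\<^sub>S Z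
     + neg_dual (lshift c\<^sub>S Y * lshift c\<^sub>S Z) + lshift d\<^sub>S Y * lshift d\<^sub>S Z"
  "lshift b\<^sub>S (Y * Z) = lshift a\<^sub>S Y * lshift b\<^sub>S Z + lshift b\<^sub>S Y * lshift a\<^sub>S Z
     + neg_dual (lshift c\<^sub>S Y * lshift d\<^sub>S Z) + lshift d\<^sub>S Y * lshift c\<^sub>S Z"
  "lshift c\<^sub>S (Y * Z) = lshift a\<^sub>S Y * lshift c\<^sub>S Z + lshift c\<^sub>S Y * lshift a\<^sub>S Z
     + neg_dual (lshift b\<^sub>S Y * lshift d\<^sub>S Z) + lshift d\<^sub>S Y * lshift b\<^sub>S Z"
  "lshift d\<^sub>S (Y * Z) = lshift a\<^sub>S Y * lshift d\<^sub>S Z + lshift d\<^sub>S Y * lshift a\<^sub>S Z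
     + neg_dual (lshift b\<^sub>S Y * lshift c\<^sub>S Z) + lshift c\<^sub>S Y * lshift b\<^sub>S Z"
  by (rule dual_eqI; simp add: pairing_shift plus_S03_dual.rep_eq scale_dual.rep_eq pairing_times
      action_gen_mult clinearD[OF clinear_pairing])+

text \<open>Coassociativity of \<open>\<delta>\<close>, checked on generators and propagated along words.\<close>

lemma action_times: "\<pi>\<^sub>R (Y * Z) f = \<pi>\<^sub>R Y (\<pi>\<^sub>R Z f)"
proof (rule linear_eq_on_words[where F = "\<pi>\<^sub>R (Y * Z)" and G = "\<lambda>f. \<pi>\<^sub>R Y (\<pi>\<^sub>R Z f)"])
  show "clinear (\<pi>\<^sub>R (Y * Z))" by (rule clinear_action)
  show "clinear (\<lambda>f. \<pi>\<^sub>R Y (\<pi>\<^sub>R Z f))" by (rule clinearI) (simp_all add: action_linear)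
  show "\<pi>\<^sub>R (Y * Z) (word_elem w) = \<pi>\<^sub>R Y (\<pi>\<^sub>R Z (word_elem w))" for w
  proof (induction w arbitrary: Y Z)
    case Nil
    show ?case
      by (simp add: action_one action_linear pairing_times clinearD[OF clinear_pairing]
          scaleC_complex_def scaleC_scaleC mult.commute)
  next
    case (Cons x w)
    have neg: "\<pi>\<^sub>R (neg_dual Z) f = - \<pi>\<^sub>R Z f" for Z f
      by (simp add: action_dual)
    show ?case
      by (cases x)
         (simp_all add: gen_elem_simps action_gen_mult lshift_times action_dual(1) neg Cons.IH
           action_linear distrib_left right_diff_distrib)
  qed
qed

lemma pairing_one: "pairing 1 (word_elem w) = prod_list (map counit_gen w)"
  by (simp add: one_S03_dual.rep_eq word_elem_abs counit.abs_eq mon_def hom_free_def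
      scaleC_complex_def)

abbreviation zero_dual :: S03_dual where
  "zero_dual \<equiv> scale_dual 0 1"

lemma pairing_zero_dual [simp]: "pairing zero_dual f = 0"
  by (simp add: scale_dual.rep_eq)

lemma action_zero_dual [simp]: "\<pi>\<^sub>R zero_dual f = 0"
  by (simp add: action_dual)

lemma lshift_eqI:
  assumes "\<And>w. pairing Z (word_elem (x # w)) = pairing Y (word_elem w)"
  shows "lshift (gen_elem x) Z = Y"
  by (rule dual_eqI) (simp add: pairing_shift assms[simplified])

lemma rshift_eqI:
  assumes "\<And>w. pairing Z (word_elem (w @ [x])) = pairing Y (word_elem w)"
  shows "rshift (gen_elem x) Z = Y"
  by (rule dual_eqI) (simp add: pairing_shift assms[simplified])

lemma lshift_one:
  "lshift a\<^sub>S 1 = 1" "lshift b\<^sub>S 1 = zero_dual" "lshift c\<^sub>S 1 = zero_dual" "lshift d\<^sub>S 1 = zero_dual"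
  unfolding gen_elem_simps[symmetric]
  by (rule lshift_eqI, simp only: pairing_one pairing_zero_dual, simp)+

lemma action_unit: "\<pi>\<^sub>R 1 f = f"
proof (rule linear_eq_on_words[where F = "\<pi>\<^sub>R 1" and G = "\<lambda>f. f"])
  show "clinear (\<pi>\<^sub>R 1)" by (rule clinear_action)
  show "clinear (\<lambda>f :: S03. f)" by (rule clinearI) simp_all
  show "\<pi>\<^sub>R 1 (word_elem w) = word_elem w" for w
  proof (induction w)
    case Nil
    show ?case using pairing_one[of "[]"] by (simp add: action_one scaleC_one)
  next
    case (Cons x w)
    then show ?case
      by (cases x) (simp_all add: gen_elem_simps action_gen_mult lshift_one)
  qed
qed

section \<open>The four generating functionals and their translates\<close>

lemma normal_replicate: "normal (replicate k GA)"
  by (induction k rule: induct_nat_012) (simp_all add: normal_def forbidden_def)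

lemma normal_GB_replicate: "normal (GB # replicate k GA)"
  using normal_replicate[of k] by (cases k) (simp_all add: normal_def forbidden_def)

lemma normal_replicate_GC: "normal (replicate k GA @ [GC])"
  using normal_replicate[of k]
  by (cases "k = 0") (simp_all add: normal_def forbidden_def successively_append_iff last_replicate)

text \<open>Powers of one letter are recognised by their set of letters, a form that simplifies when
  a letter is split off.\<close>

lemma replicate_iff:
  "(\<exists>k. w = replicate k x) \<longleftrightarrow> set w \<subseteq> {x}" "w = replicate (length w) x \<longleftrightarrow> set w \<subseteq> {x}"
proof -
  have 1: "w = replicate (length w) x" if "set w \<subseteq> {x}"
    using that by (intro replicate_eqI) auto
  have 2: "set w \<subseteq> {x}" if "w = replicate k x" for k
    using that by auto
  show "(\<exists>k. w = replicate k x) \<longleftrightarrow> set w \<subseteq> {x}" "w = replicate (length w) x \<longleftrightarrow> set w \<subseteq> {x}"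
    using 1 2 by blast+
qed

lemma counit_word: "prod_list (map counit_gen w) = (if set w \<subseteq> {GA} then 1 else 0)"
proof (induction w)
  case (Cons x w)
  then show ?case by (cases x) simp_all
qed simp

lemma pairing_A: "pairing A\<^sub>S (word_elem w) = (if set w \<subseteq> {GA} then of_nat (length w) else 0)"
  unfolding A\<^sub>S_def pairing_word_functional_if replicate_iff(2)
  using normal_replicate by (auto simp flip: replicate_iff(1))

lemma pairing_B: "pairing B\<^sub>S (word_elem w) = (if \<exists>k. w = GB # replicate k GA then 1 else 0)"
  unfolding B\<^sub>S_def pairing_word_functional_if using normal_GB_replicate by auto

lemma pairing_C: "pairing C\<^sub>S (word_elem w) = (if \<exists>k. w = replicate k GA @ [GC] then 1 else 0)"
  unfolding C\<^sub>S_def pairing_word_functional_if using normal_replicate_GC by auto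

lemma pairing_D: "pairing D\<^sub>S (word_elem w) = (if w = [GD] then 1 else 0)"
  unfolding D\<^sub>S_def pairing_word_functional_if by (simp add: normal_def)

text \<open>The coordinates for the basis of normal words; for other \<open>w\<close> it is the zero
  functional. \<open>coeff []\<close> is not the counit: it vanishes on every nonempty power of
  \<open>a\<close>.\<close>

definition coeff :: "gen list \<Rightarrow> S03_dual" where
  "coeff w = word_functional (\<lambda>u. if u = w then 1 else 0)"

lemma pairing_coeff: "normal w \<Longrightarrow> pairing (coeff w) (word_elem u) = (if u = w then 1 else 0)"
  by (simp add: coeff_def pairing_word_functional_if)

lemma normal_Nil: "normal []"
  by (simp add: normal_def)

text \<open>On powers of \<open>a\<close> the functional \<open>A\<^sub>S\<close> counts letters and
  the counit is \<open>1\<close>, so splitting off a first \<open>a\<close> adds one counit. This is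
  how the letter count enters \<open>action_A\<close>.\<close>

lemma lshift_A: "lshift (gen_elem x) A\<^sub>S = (if x = GA then A\<^sub>S + 1 else zero_dual)"
  by (rule lshift_eqI)
     (simp add: pairing_A pairing_one counit_word plus_S03_dual.rep_eq del: word_elem_simps)

lemma lshift_B: "lshift (gen_elem x) B\<^sub>S = (if x = GB then 1 else zero_dual)"
  by (rule lshift_eqI)
     (simp add: pairing_B pairing_one counit_word replicate_iff del: word_elem_simps)

text \<open>The marked letter of \<open>C\<^sub>S\<close> is the last one of \<open>a^k c\<close>,
  so right translation isolates it and leaves the counit on the rest.\<close>

lemma rshift_C: "rshift (gen_elem x) C\<^sub>S = (if x = GC then 1 else zero_dual)"
  by (rule rshift_eqI)
     (simp add: pairing_C pairing_one counit_word replicate_iff del: word_elem_simps)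

lemma lshift_D: "lshift (gen_elem x) D\<^sub>S = (if x = GD then coeff [] else zero_dual)"
  by (rule lshift_eqI)
     (simp add: pairing_D pairing_coeff normal_Nil del: word_elem_simps)

lemma lshift_coeff_Nil: "lshift (gen_elem x) (coeff []) = zero_dual"
  by (rule lshift_eqI) (simp add: pairing_coeff normal_Nil del: word_elem_simps)

text \<open>In the coproduct of a letter \<open>x\<close>, \<open>flipB x\<close> is the left
  partner of \<open>b\<close>, always with sign plus; \<open>flipC x\<close> is the left partner of
  \<open>c\<close>, with sign \<open>signC x\<close>.\<close>

primrec flipB :: "gen \<Rightarrow> gen" where
  "flipB GA = GB" | "flipB GB = GA" | "flipB GC = GD" | "flipB GD = GC"

primrec flipC :: "gen \<Rightarrow> gen" where
  "flipC GA = GC" | "flipC GC = GA" | "flipC GB = GD" | "flipC GD = GB"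

primrec signC :: "gen \<Rightarrow> complex" where
  "signC GA = - 1" | "signC GC = 1" | "signC GB = 1" | "signC GD = - 1"

lemma flip_simps [simp]:
  "flipB (flipB x) = x" "flipC (flipC x) = x" "signC (flipC x) = - signC x"
  "signC x * signC x = 1" "flipB x \<noteq> x" "flipC x \<noteq> x"
  by (cases x; simp)+

lemma action_A: "\<pi>\<^sub>R A\<^sub>S (gen_elem x * f) = gen_elem x * (\<pi>\<^sub>R A\<^sub>S f + f)"
  by (cases x)
     (simp_all add: gen_elem_simps action_gen_mult lshift_A[of GA, unfolded gen_elem_simps]
       lshift_A[of GB, unfolded gen_elem_simps] lshift_A[of GC, unfolded gen_elem_simps]
       lshift_A[of GD, unfolded gen_elem_simps] action_dual(1) action_unit)

text \<open>In the right tensor factor \<open>B\<^sub>S\<close> demands \<open>b\<close> as first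
  letter and is the counit on what follows, so the tail \<open>f\<close> is left unchanged.\<close>

lemma action_B: "\<pi>\<^sub>R B\<^sub>S (gen_elem x * f) = gen_elem (flipB x) * f"
  by (cases x)
     (simp_all add: gen_elem_simps action_gen_mult lshift_B[of GA, unfolded gen_elem_simps]
       lshift_B[of GB, unfolded gen_elem_simps] lshift_B[of GC, unfolded gen_elem_simps]
       lshift_B[of GD, unfolded gen_elem_simps] action_unit)

lemma action_C: "\<pi>\<^sub>R C\<^sub>S (f * gen_elem x) = signC x *\<^sub>C (f * gen_elem (flipC x))"
  by (cases x)
     (simp_all add: gen_elem_simps action_mult_gen rshift_C[of GA, unfolded gen_elem_simps]
       rshift_C[of GB, unfolded gen_elem_simps] rshift_C[of GC, unfolded gen_elem_simps]
       rshift_C[of GD, unfolded gen_elem_simps] action_unit scaleC_one)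

lemma action_coeff_Nil:
  "\<pi>\<^sub>R (coeff []) (gen_elem x * f) = 0" "\<pi>\<^sub>R (coeff []) 1 = 1"
proof -
  show "\<pi>\<^sub>R (coeff []) (gen_elem x * f) = 0"
    by (cases x)
       (simp_all add: gen_elem_simps action_gen_mult lshift_coeff_Nil[of GA, unfolded gen_elem_simps]
       lshift_coeff_Nil[of GB, unfolded gen_elem_simps] lshift_coeff_Nil[of GC, unfolded gen_elem_simps]
       lshift_coeff_Nil[of GD, unfolded gen_elem_simps])
  show "\<pi>\<^sub>R (coeff []) 1 = 1"
    using pairing_coeff[OF normal_Nil, of "[]"] by (simp add: action_one scaleC_one)
qed

lemma action_D:
  "\<pi>\<^sub>R D\<^sub>S (a\<^sub>S * f) = d\<^sub>S * \<pi>\<^sub>R (coeff []) f" "\<pi>\<^sub>R D\<^sub>S (b\<^sub>S * f) = - (c\<^sub>S * \<pi>\<^sub>R (coeff []) f)"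
  "\<pi>\<^sub>R D\<^sub>S (c\<^sub>S * f) = - (b\<^sub>S * \<pi>\<^sub>R (coeff []) f)" "\<pi>\<^sub>R D\<^sub>S (d\<^sub>S * f) = a\<^sub>S * \<pi>\<^sub>R (coeff []) f"
  by (simp_all add: action_gen_mult lshift_D[of GA, unfolded gen_elem_simps]
       lshift_D[of GB, unfolded gen_elem_simps] lshift_D[of GC, unfolded gen_elem_simps]
       lshift_D[of GD, unfolded gen_elem_simps])

text \<open>Past the first letter \<open>D\<^sub>S\<close> acts through \<open>coeff []\<close>,
  which kills any product that begins with a letter.\<close>

lemma action_D_long: "\<pi>\<^sub>R D\<^sub>S (gen_elem x * (gen_elem y * f)) = 0"
  by (cases x) (simp_all add: gen_elem_simps action_D action_coeff_Nil)

lemma action_generators_one: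
  "\<pi>\<^sub>R A\<^sub>S 1 = 0" "\<pi>\<^sub>R B\<^sub>S 1 = 0" "\<pi>\<^sub>R C\<^sub>S 1 = 0" "\<pi>\<^sub>R D\<^sub>S 1 = 0"
  using pairing_A[of "[]"] pairing_B[of "[]"] pairing_C[of "[]"] pairing_D[of "[]"]
  by (simp_all add: action_one)


section \<open>Words of a fixed length\<close>

lemma word_in_W: "length w = N \<Longrightarrow> word_elem w \<in> W N"
  unfolding W_def
  by (cases "normal w")
     (auto simp: word_elem_eq_0 cvs.span_zero simp del: word_elem_simps intro!: cvs.span_base)

lemma subspace_W: "cvs.subspace (W N)"
  unfolding W_def by (rule cvs.subspace_span)

lemmas W_closed = cvs.subspace_add[OF subspace_W] cvs.subspace_diff[OF subspace_W]
  cvs.subspace_neg[OF subspace_W] cvs.subspace_scale[OF subspace_W] cvs.subspace_0[OF subspace_W]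

lemma W_induct [consumes 1, case_names zero word]:
  assumes "f \<in> W N" "P 0"
    and "\<And>c w f. length w = N \<Longrightarrow> f \<in> W N \<Longrightarrow> P f \<Longrightarrow> P (c *\<^sub>C word_elem w + f)"
  shows "P f"
proof -
  have "f \<in> W N \<and> P f"
    using assms(1)[unfolded W_def]
  proof (induction rule: cvs.span_induct_alt)
    case base
    show ?case using assms(2) W_closed(5) by blast
  next
    case (step c x y)
    then obtain w where w: "x = word_elem w" "length w = N" by blast
    have "c *\<^sub>C word_elem w + y \<in> W N"
      using step(2) word_in_W[OF w(2)] by (blast intro: W_closed)
    then show ?case using assms(3)[OF w(2)] step(2) w(1) by blast
  qed
  then show ?thesis ..
qed

lemma linear_eq_on_W:
  assumes "clinear F" "clinear G" "\<And>w. length w = N \<Longrightarrow> F (word_elem w) = G (word_elem w)"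
    and "f \<in> W N"
  shows "F f = G f"
  using assms(4)
  by (induction rule: W_induct)
     (simp_all add: clinearD[OF assms(1)] clinearD[OF assms(2)] assms(3) del: word_elem_simps)

lemma gen_mult_W: "f \<in> W N \<Longrightarrow> gen_elem x * f \<in> W (Suc N)"
proof (induction rule: W_induct)
  case (word c w f)
  have "gen_elem x * word_elem w \<in> W (Suc N)"
    using word_in_W[of "x # w" "Suc N"] word by simp
  then show ?case
    using word by (simp add: distrib_left mult_scaleC_right W_closed)
qed (simp add: W_closed)

text \<open>Each term in the coproduct of a letter has a single letter on either side, so
  contracting the right side preserves length.\<close>

lemma action_word_W: "\<pi>\<^sub>R Z (word_elem w) \<in> W (length w)"
proof (induction w arbitrary: Z)
  case Nil
  show ?case using word_in_W[of "[]" 0] by (simp add: action_one W_closed)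
next
  case (Cons x w)
  have "y * \<pi>\<^sub>R Z (word_elem w) \<in> W (Suc (length w))" if "y \<in> {a\<^sub>S, b\<^sub>S, c\<^sub>S, d\<^sub>S}" for y Z
    using that gen_mult_W[OF Cons.IH, of _ Z] gen_elem_simps by (metis empty_iff insert_iff)
  then show ?case
    by (cases x) (auto simp: gen_elem_simps action_gen_mult intro!: W_closed)
qed

lemma action_W: "f \<in> W N \<Longrightarrow> \<pi>\<^sub>R Z f \<in> W N"
proof (induction rule: W_induct)
  case (word c w f)
  then show ?case
    using action_word_W[of Z w] by (simp add: action_linear W_closed del: word_elem_simps)
qed (simp add: action_linear W_closed)

lemma subrep_W: "subrep (W N)"
  by (simp add: subrep_def subspace_W action_W)

lemma clinear_scale: "clinear (\<lambda>f :: S03. c *\<^sub>C f)"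
  by (rule clinearI) (simp_all add: scaleC_add_right scaleC_scaleC mult.commute)

lemma action_A_word: "\<pi>\<^sub>R A\<^sub>S (word_elem w) = of_nat (length w) *\<^sub>C word_elem w"
  by (induction w)
     (simp_all add: action_A action_generators_one scaleC_add_left scaleC_one mult_scaleC_right
       distrib_left add.commute)

lemma A_acts_on_W: "acts_as A\<^sub>S (of_nat N) (W N)"
  unfolding acts_as_def
  by (auto intro!: linear_eq_on_W[where F = "\<pi>\<^sub>R A\<^sub>S" and N = N] clinear_action clinear_scale action_A_word)

lemma long_word:
  assumes "N \<ge> 2" "length w = N"
  obtains x f y where "w = x # f @ [y]" "length f = N - 2"
proof -
  from assms obtain x g where w: "w = x # g" "g \<noteq> []" by (cases w; cases "tl w") auto
  then show thesis using assms that[of x "butlast g" "last g"] by simp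
qed

lemma B_square:
  assumes "N \<ge> 2" "f \<in> W N"
  shows "\<pi>\<^sub>R B\<^sub>S (\<pi>\<^sub>R B\<^sub>S f) = f"
proof (rule linear_eq_on_W[where F = "\<lambda>f. \<pi>\<^sub>R B\<^sub>S (\<pi>\<^sub>R B\<^sub>S f)" and G = "\<lambda>f. f", OF _ _ _ assms(2)])
  show "\<pi>\<^sub>R B\<^sub>S (\<pi>\<^sub>R B\<^sub>S (word_elem w)) = word_elem w" if len: "length w = N" for w
    using long_word[OF assms(1) len] by (metis action_B flip_simps(1) word_elem_simps(2))
qed (auto intro!: clinearI simp: action_linear)

text \<open>Flipping the last letter twice restores it, and the two signs met on the way are
  opposite.\<close>

lemma C_square:
  assumes "N \<ge> 2" "f \<in> W N"
  shows "\<pi>\<^sub>R C\<^sub>S (\<pi>\<^sub>R C\<^sub>S f) = - f"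
proof (rule linear_eq_on_W[where F = "\<lambda>f. \<pi>\<^sub>R C\<^sub>S (\<pi>\<^sub>R C\<^sub>S f)" and G = "\<lambda>f. - f", OF _ _ _ assms(2)])
  show "\<pi>\<^sub>R C\<^sub>S (\<pi>\<^sub>R C\<^sub>S (word_elem w)) = - word_elem w" if len: "length w = N" for w
  proof -
    obtain x f y where w: "w = x # f @ [y]" using long_word[OF assms(1) len] by metis
    have "\<pi>\<^sub>R C\<^sub>S (\<pi>\<^sub>R C\<^sub>S (g * gen_elem y)) = - (g * gen_elem y)" for g
      by (simp add: action_C action_linear scaleC_scaleC scaleC_one)
    from this[of "word_elem (x # f)"] show ?thesis by (simp add: w mult.assoc)
  qed
qed (auto intro!: clinearI simp: action_linear)

lemma B_C_commute:
  assumes "N \<ge> 2" "f \<in> W N"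
  shows "\<pi>\<^sub>R B\<^sub>S (\<pi>\<^sub>R C\<^sub>S f) = \<pi>\<^sub>R C\<^sub>S (\<pi>\<^sub>R B\<^sub>S f)"
proof (rule linear_eq_on_W[where F = "\<lambda>f. \<pi>\<^sub>R B\<^sub>S (\<pi>\<^sub>R C\<^sub>S f)" and G = "\<lambda>f. \<pi>\<^sub>R C\<^sub>S (\<pi>\<^sub>R B\<^sub>S f)",
      OF _ _ _ assms(2)])
  show "\<pi>\<^sub>R B\<^sub>S (\<pi>\<^sub>R C\<^sub>S (word_elem w)) = \<pi>\<^sub>R C\<^sub>S (\<pi>\<^sub>R B\<^sub>S (word_elem w))" if len: "length w = N" for w
  proof -
    obtain x f y where w: "w = x # f @ [y]" using long_word[OF assms(1) len] by metis
    have C: "\<pi>\<^sub>R C\<^sub>S (gen_elem z * (word_elem f * gen_elem y))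
        = signC y *\<^sub>C (gen_elem z * (word_elem f * gen_elem (flipC y)))" for z
      using action_C[of "gen_elem z * word_elem f" y] by (simp add: mult.assoc)
    show ?thesis by (simp add: w C action_B action_linear)
  qed
qed (auto intro!: clinearI simp: action_linear)

lemma D_acts_zero:
  assumes "N \<ge> 2" "f \<in> W N"
  shows "\<pi>\<^sub>R D\<^sub>S f = 0"
proof (rule linear_eq_on_W[where F = "\<pi>\<^sub>R D\<^sub>S" and G = "\<lambda>f. 0", OF clinear_action _ _ assms(2)])
  show "\<pi>\<^sub>R D\<^sub>S (word_elem w) = 0" if len: "length w = N" for w
  proof -
    obtain x f y where w: "w = x # f @ [y]" using long_word[OF assms(1) len] by metis
    \<comment> \<open>If the middle is empty, the tail after the second letter is
      \<open>1\<close>.\<close>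
    then show ?thesis by (cases f) (simp_all add: action_D_long action_D_long[of _ _ 1, simplified])
  qed
qed (auto intro!: clinearI)

section \<open>Joint eigenvectors of \<open>B\<^sub>S\<close> and \<open>C\<^sub>S\<close>\<close>

definition eigen :: "complex \<Rightarrow> complex \<Rightarrow> S03 \<Rightarrow> bool" where
  "eigen \<epsilon> \<epsilon>' v \<longleftrightarrow> \<pi>\<^sub>R B\<^sub>S v = \<epsilon> *\<^sub>C v \<and> \<pi>\<^sub>R C\<^sub>S v = (\<i> * \<epsilon>') *\<^sub>C v"

lemma signs_square: "\<epsilon> \<in> signs \<Longrightarrow> \<epsilon> * \<epsilon> = 1"
  by (auto simp: signs_def)

definition proj :: "complex \<Rightarrow> complex \<Rightarrow> S03 \<Rightarrow> S03" where
  "proj \<epsilon> \<epsilon>' f = (let g = f + \<epsilon> *\<^sub>C \<pi>\<^sub>R B\<^sub>S f in (1 / 4) *\<^sub>C (g - (\<i> * \<epsilon>') *\<^sub>C \<pi>\<^sub>R C\<^sub>S g))"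

lemma clinear_proj: "clinear (proj \<epsilon> \<epsilon>')"
  by (rule clinearI)
     (simp_all add: proj_def action_linear scaleC_add_right cvs.scale_right_diff_distrib
       scaleC_scaleC mult_ac)

lemma proj_eigen:
  assumes "N \<ge> 2" "f \<in> W N" "\<epsilon> \<in> signs" "\<epsilon>' \<in> signs"
  shows "eigen \<epsilon> \<epsilon>' (proj \<epsilon> \<epsilon>' f)"
proof -
  define g where "g = f + \<epsilon> *\<^sub>C \<pi>\<^sub>R B\<^sub>S f"
  have g: "g \<in> W N"
    unfolding g_def using assms(2) by (intro W_closed action_W)
  have B: "\<pi>\<^sub>R B\<^sub>S g = \<epsilon> *\<^sub>C g"
    by (simp add: g_def action_linear B_square[OF assms(1,2)] scaleC_add_right scaleC_scaleC
        signs_square[OF assms(3)] scaleC_one add.commute)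
  have BC: "\<pi>\<^sub>R B\<^sub>S (\<pi>\<^sub>R C\<^sub>S g) = \<epsilon> *\<^sub>C \<pi>\<^sub>R C\<^sub>S g"
    by (simp add: B_C_commute[OF assms(1) g] B action_linear)
  have p: "proj \<epsilon> \<epsilon>' f = (1 / 4) *\<^sub>C (g - (\<i> * \<epsilon>') *\<^sub>C \<pi>\<^sub>R C\<^sub>S g)"
    by (simp add: proj_def g_def Let_def)
  \<comment> \<open>This matches \<open>C_square\<close>: the operator and its intended eigenvalue
    both square to \<open>- 1\<close>.\<close>
  have "(\<i> * \<epsilon>') * (\<i> * \<epsilon>') = - 1"
    using signs_square[OF assms(4)] by (simp add: mult_ac mult.left_commute[of \<epsilon>' \<i>])
  then have "\<pi>\<^sub>R C\<^sub>S (g - (\<i> * \<epsilon>') *\<^sub>C \<pi>\<^sub>R C\<^sub>S g) = (\<i> * \<epsilon>') *\<^sub>C (g - (\<i> * \<epsilon>') *\<^sub>C \<pi>\<^sub>R C\<^sub>S g)"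
    by (simp add: action_linear C_square[OF assms(1) g] cvs.scale_right_diff_distrib scaleC_scaleC
        scaleC_one add.commute)
  moreover have "\<pi>\<^sub>R B\<^sub>S (g - (\<i> * \<epsilon>') *\<^sub>C \<pi>\<^sub>R C\<^sub>S g) = \<epsilon> *\<^sub>C (g - (\<i> * \<epsilon>') *\<^sub>C \<pi>\<^sub>R C\<^sub>S g)"
    by (simp add: action_linear B BC cvs.scale_right_diff_distrib scaleC_scaleC mult.commute)
  ultimately show ?thesis
    by (simp add: eigen_def p action_linear scaleC_scaleC mult.commute)
qed

lemma proj_on_eigen:
  assumes "eigen \<epsilon>\<^sub>0 \<epsilon>\<^sub>0' v" "\<epsilon>\<^sub>0 \<in> signs" "\<epsilon>\<^sub>0' \<in> signs" "\<epsilon> \<in> signs" "\<epsilon>' \<in> signs"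
  shows "proj \<epsilon> \<epsilon>' v = (if \<epsilon> = \<epsilon>\<^sub>0 \<and> \<epsilon>' = \<epsilon>\<^sub>0' then v else 0)"
proof -
  have B: "\<pi>\<^sub>R B\<^sub>S v = \<epsilon>\<^sub>0 *\<^sub>C v" and C: "\<pi>\<^sub>R C\<^sub>S v = (\<i> * \<epsilon>\<^sub>0') *\<^sub>C v"
    using assms(1) by (simp_all add: eigen_def)
  have g: "v + \<epsilon> *\<^sub>C \<pi>\<^sub>R B\<^sub>S v = (1 + \<epsilon> * \<epsilon>\<^sub>0) *\<^sub>C v"
    by (simp add: B scaleC_add_left scaleC_scaleC scaleC_one)
  have q: "(2 - \<i> * (2 * \<i>)) / 4 = 1" by (simp add: complex_eq_iff)
  \<comment> \<open>The scalar equals \<open>(1 + \<epsilon> * \<epsilon>\<^sub>0) * (1 +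
    \<epsilon>' * \<epsilon>\<^sub>0') / 4\<close>. Each factor is 2 if the signs agree and 0 if
    they differ.\<close>
  have "proj \<epsilon> \<epsilon>' v = ((1 / 4) * ((1 + \<epsilon> * \<epsilon>\<^sub>0) - (\<i> * \<epsilon>') * ((1 + \<epsilon> * \<epsilon>\<^sub>0) * (\<i> * \<epsilon>\<^sub>0')))) *\<^sub>C v"
    unfolding proj_def Let_def g action_linear(2) C scaleC_scaleC
      cvs.scale_left_diff_distrib[symmetric] ..
  also have "\<dots> = (if \<epsilon> = \<epsilon>\<^sub>0 \<and> \<epsilon>' = \<epsilon>\<^sub>0' then v else 0)"
    using assms(2-) by (auto simp: signs_def scaleC_one q)
  finally show ?thesis .
qed

text \<open>Terms containing \<open>B\<^sub>S\<close>, \<open>C\<^sub>S\<close> or both carry a sign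
  and cancel over the four choices, leaving four quarters of \<open>f\<close>.\<close>

lemma sum_proj: "(\<Sum>(\<epsilon>, \<epsilon>')\<in>signs \<times> signs. proj \<epsilon> \<epsilon>' f) = f"
proof -
  have q: "(1 / 4) *\<^sub>C f + (1 / 4) *\<^sub>C f + (1 / 4) *\<^sub>C f + (1 / 4) *\<^sub>C f = f"
    unfolding scaleC_add_left[symmetric] by (simp add: scaleC_one)
  have "(\<Sum>(\<epsilon>, \<epsilon>')\<in>signs \<times> signs. proj \<epsilon> \<epsilon>' f)
      = proj 1 1 f + proj 1 (- 1) f + (proj (- 1) 1 f + proj (- 1) (- 1) f)"
    by (simp add: signs_def sum.cartesian_product[symmetric])
  also have "\<dots> = (1 / 4) *\<^sub>C f + (1 / 4) *\<^sub>C f + (1 / 4) *\<^sub>C f + (1 / 4) *\<^sub>C f"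
    unfolding scaleC_add_right[symmetric]
    by (simp add: proj_def Let_def scaleC_one action_linear flip: scaleC_add_right)
  finally show ?thesis by (simp add: q)
qed

text \<open>The scalar is chosen before the vector: it depends only on \<open>Z\<close>,
  \<open>N\<close> and the two signs. This uniformity is what later makes lines with equal signs
  isomorphic.\<close>

lemma s03_scalar:
  assumes "Z \<in> s03" "N \<ge> 2"
  shows "\<exists>c. \<forall>v\<in>W N. eigen \<epsilon> \<epsilon>' v \<longrightarrow> \<pi>\<^sub>R Z v = c *\<^sub>C v"
  using assms(1)
proof induction
  case one
  then show ?case by (intro exI[of _ 1]) (simp add: action_unit scaleC_one)
next
  case A
  then show ?case using A_acts_on_W by (auto simp: acts_as_def)
next
  case B
  then show ?case by (auto simp: eigen_def)
next
  case C
  then show ?case by (auto simp: eigen_def)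
next
  case D
  then show ?case using D_acts_zero[OF assms(2)] by (intro exI[of _ 0]) simp
next
  case (add u v)
  then obtain c d where "\<forall>x\<in>W N. eigen \<epsilon> \<epsilon>' x \<longrightarrow> \<pi>\<^sub>R u x = c *\<^sub>C x"
    "\<forall>x\<in>W N. eigen \<epsilon> \<epsilon>' x \<longrightarrow> \<pi>\<^sub>R v x = d *\<^sub>C x" by blast
  then show ?case by (intro exI[of _ "c + d"]) (simp add: action_dual scaleC_add_left)
next
  case (scale u e)
  then obtain c where "\<forall>x\<in>W N. eigen \<epsilon> \<epsilon>' x \<longrightarrow> \<pi>\<^sub>R u x = c *\<^sub>C x" by blast
  then show ?case by (intro exI[of _ "e * c"]) (simp add: action_dual scaleC_scaleC)
next
  case (mult u v)
  then obtain c d where "\<forall>x\<in>W N. eigen \<epsilon> \<epsilon>' x \<longrightarrow> \<pi>\<^sub>R u x = c *\<^sub>C x"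
    "\<forall>x\<in>W N. eigen \<epsilon> \<epsilon>' x \<longrightarrow> \<pi>\<^sub>R v x = d *\<^sub>C x" by blast
  then show ?case
    by (intro exI[of _ "d * c"]) (simp add: action_times action_linear scaleC_scaleC)
qed

section \<open>One-dimensional subrepresentations\<close>

lemma dim_span_singleton: "v \<noteq> 0 \<Longrightarrow> cvs.dim (cvs.span {v :: S03}) = 1"
  by (simp add: cvs.dim_eq_card_independent cvs.dependent_single)

lemma span_singleton: "cvs.span {v :: S03} = range (\<lambda>c. c *\<^sub>C v)"
  by (rule cvs.span_singleton)

lemma one_dim_rep_span:
  assumes "N \<ge> 2" "v \<in> W N" "v \<noteq> 0" "eigen \<epsilon> \<epsilon>' v"
  shows "one_dim_rep (cvs.span {v}) \<epsilon> \<epsilon>'"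
proof -
  have "\<pi>\<^sub>R Z f \<in> cvs.span {v}" if Z: "Z \<in> s03" and f: "f \<in> cvs.span {v}" for Z f
  proof -
    obtain c where "\<pi>\<^sub>R Z v = c *\<^sub>C v" using s03_scalar[OF Z assms(1)] assms by blast
    then show ?thesis using f by (auto simp: span_singleton action_linear scaleC_scaleC)
  qed
  then have "subrep (cvs.span {v})" by (simp add: subrep_def)
  moreover have "has_character (cvs.span {v}) \<epsilon> \<epsilon>'"
    using assms(4) D_acts_zero[OF assms(1,2)]
    by (auto simp: has_character_def acts_as_def span_singleton eigen_def action_linear
        scaleC_scaleC mult_ac)
  ultimately show ?thesis using dim_span_singleton[OF assms(3)] unfolding one_dim_rep_def by blast
qed

lemma irreducible_span:
  assumes "subrep (cvs.span {v})" "v \<noteq> 0"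
  shows "irreducible_rep (cvs.span {v})"
  unfolding irreducible_rep_def
proof (intro conjI allI impI)
  show "cvs.span {v} \<noteq> {0}"
    using cvs.span_base[of v "{v}"] assms(2) by auto
  fix V
  assume V: "subrep V \<and> V \<subseteq> cvs.span {v}"
  show "V = {0} \<or> V = cvs.span {v}"
  proof (cases "V \<subseteq> {0}")
    case True
    then show ?thesis using V cvs.subspace_0 by (auto simp: subrep_def)
  next
    case False
    then obtain x where x: "x \<in> V" "x \<noteq> 0" by blast
    then obtain c where c: "x = c *\<^sub>C v" using V by (auto simp: span_singleton)
    then have "v = inverse c *\<^sub>C x" using x by (simp add: scaleC_scaleC scaleC_one)
    then have "v \<in> V" using V x(1) by (simp add: subrep_def cvs.subspace_scale)
    then have "cvs.span {v} \<subseteq> V" using V by (intro cvs.span_minimal) (auto simp: subrep_def)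
    then show ?thesis using V by blast
  qed
qed (rule assms(1))


section \<open>Direct sums of lines\<close>

text \<open>With a biorthogonal family, \<open>\<Lambda> i\<close> reads the coefficient at
  \<open>i\<close> off any combination, which gives uniqueness of the summands and the dimension at
  once. It serves degree one with the letter coordinates and higher degrees with
  \<open>dual_wN\<close>.\<close>

lemma direct_sum_lines:
  fixes v :: "'i \<Rightarrow> S03" and \<Lambda> :: "'i \<Rightarrow> S03 \<Rightarrow> complex"
  assumes fin: "finite I" and lin: "\<And>i. i \<in> I \<Longrightarrow> clinear (\<Lambda> i)"
    and dual: "\<And>i k. i \<in> I \<Longrightarrow> k \<in> I \<Longrightarrow> \<Lambda> i (v k) = (if i = k then 1 else 0)"
    and V: "V = cvs.span (v ` I)"
  shows "direct_sum I (\<lambda>i. cvs.span {v i}) V" "cvs.dim V = card I"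
proof -
  have inj: "inj_on v I" by (rule inj_onI) (metis dual zero_neq_one)
  have coeff: "\<Lambda> i (\<Sum>k\<in>I. c k *\<^sub>C v k) = c i" if "i \<in> I" for i c
  proof -
    have "\<Lambda> i (\<Sum>k\<in>J. c k *\<^sub>C v k) = (\<Sum>k\<in>J. c k * \<Lambda> i (v k))" if "finite J" for J
      using that
      by (induction J) (simp_all add: clinearD[OF lin[OF \<open>i \<in> I\<close>]] scaleC_complex_def)
    then show ?thesis using fin that by (simp add: dual if_distrib cong: if_cong)
  qed
  have combs: "V = {\<Sum>i\<in>I. c i *\<^sub>C v i | c. True}"
  proof -
    have "V = range (\<lambda>c. \<Sum>x\<in>v ` I. c x *\<^sub>C x)"
      using fin by (simp add: V cvs.span_finite)
    also have "\<dots> = {\<Sum>i\<in>I. c i *\<^sub>C v i | c. True}"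
    proof (intro equalityI subsetI)
      fix x
      assume "x \<in> range (\<lambda>c. \<Sum>x\<in>v ` I. c x *\<^sub>C x)"
      then obtain c where "x = (\<Sum>x\<in>v ` I. c x *\<^sub>C x)" by (rule rangeE)
      then have "x = (\<Sum>i\<in>I. c (v i) *\<^sub>C v i)" by (simp add: sum.reindex[OF inj])
      then show "x \<in> {\<Sum>i\<in>I. c i *\<^sub>C v i | c. True}"
        unfolding mem_Collect_eq by (intro exI[of _ "\<lambda>i. c (v i)"] conjI TrueI)
    next
      fix x
      assume "x \<in> {\<Sum>i\<in>I. c i *\<^sub>C v i | c. True}"
      then obtain c where x: "x = (\<Sum>i\<in>I. c i *\<^sub>C v i)" by blast
      \<comment> \<open>Coefficients over a finite span are indexed by vectors, so those indexed by
        \<open>I\<close> are transported along the inverse of \<open>v\<close>.\<close>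
      have "x = (\<Sum>y\<in>v ` I. c (the_inv_into I v y) *\<^sub>C y)"
        by (simp add: x sum.reindex[OF inj] the_inv_into_f_f[OF inj])
      then show "x \<in> range (\<lambda>c. \<Sum>x\<in>v ` I. c x *\<^sub>C x)"
        unfolding image_iff by (intro bexI[of _ "\<lambda>y. c (the_inv_into I v y)"] UNIV_I)
    qed
    finally show ?thesis .
  qed
  have lines: "\<exists>c. \<forall>i\<in>I. u i = c i *\<^sub>C v i" if "\<forall>i\<in>I. u i \<in> cvs.span {v i}" for u
    using that unfolding span_singleton image_iff by (intro bchoice) blast
  have "V = {\<Sum>i\<in>I. u i | u. \<forall>i\<in>I. u i \<in> cvs.span {v i}}"
    unfolding combs
  proof (intro equalityI subsetI)
    fix x
    assume "x \<in> {\<Sum>i\<in>I. c i *\<^sub>C v i | c. True}"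
    then obtain c where "x = (\<Sum>i\<in>I. c i *\<^sub>C v i)" by blast
    moreover have "\<forall>i\<in>I. c i *\<^sub>C v i \<in> cvs.span {v i}"
      by (simp add: cvs.span_base cvs.span_scale)
    ultimately show "x \<in> {\<Sum>i\<in>I. u i | u. \<forall>i\<in>I. u i \<in> cvs.span {v i}}"
      unfolding mem_Collect_eq by (intro exI[of _ "\<lambda>i. c i *\<^sub>C v i"] conjI)
  next
    fix x
    assume "x \<in> {\<Sum>i\<in>I. u i | u. \<forall>i\<in>I. u i \<in> cvs.span {v i}}"
    then obtain u where u: "x = (\<Sum>i\<in>I. u i)" "\<forall>i\<in>I. u i \<in> cvs.span {v i}" by blast
    obtain c where "\<forall>i\<in>I. u i = c i *\<^sub>C v i" using lines[OF u(2)] ..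
    then have "x = (\<Sum>i\<in>I. c i *\<^sub>C v i)" unfolding u(1) by (intro sum.cong) simp_all
    then show "x \<in> {\<Sum>i\<in>I. c i *\<^sub>C v i | c. True}" by blast
  qed
  moreover have "\<forall>i\<in>I. u i = 0" if u: "\<forall>i\<in>I. u i \<in> cvs.span {v i}" "(\<Sum>i\<in>I. u i) = 0" for u
  proof -
    obtain c where c: "\<forall>i\<in>I. u i = c i *\<^sub>C v i" using lines[OF u(1)] ..
    then have "(\<Sum>i\<in>I. c i *\<^sub>C v i) = 0" using u(2) by simp
    then have "c i = 0" if "i \<in> I" for i
      using coeff[OF that, of c] clinearD(3)[OF lin[OF that]] by simp
    then show ?thesis using c by simp
  qed
  ultimately show "direct_sum I (\<lambda>i. cvs.span {v i}) V"
    unfolding direct_sum_def using fin by blast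
  have "cvs.independent (v ` I)"
  proof (rule cvs.independent_if_scalars_zero)
    fix c x
    assume c: "(\<Sum>x\<in>v ` I. c x *\<^sub>C x) = 0" and "x \<in> v ` I"
    then obtain i where i: "i \<in> I" "x = v i" by blast
    have "(\<Sum>i\<in>I. c (v i) *\<^sub>C v i) = 0" using c by (simp add: sum.reindex[OF inj])
    then show "c x = 0"
      using coeff[OF i(1), of "\<lambda>i. c (v i)"] clinearD(3)[OF lin[OF i(1)]] i(2) by simp
  qed (use fin in simp)
  then show "cvs.dim V = card I"
    unfolding V by (simp add: cvs.dim_eq_card_independent card_image[OF inj])
qed

section \<open>The vectors \<open>wN\<close>\<close>

text \<open>The letters \<open>a\<close> and \<open>d\<close> represent the orbits
  \<open>{a, b}\<close>, \<open>{c, d}\<close> of \<open>flipB\<close> and also the orbits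
  \<open>{a, c}\<close>, \<open>{b, d}\<close> of \<open>flipC\<close>. A form chooses one
  representative for each end.\<close>

primrec first_letter :: "form \<Rightarrow> gen" where
  "first_letter AA = GA" | "first_letter DD = GD" | "first_letter AD = GA" | "first_letter DA = GD"

primrec last_letter :: "form \<Rightarrow> gen" where
  "last_letter AA = GA" | "last_letter DD = GD" | "last_letter AD = GD" | "last_letter DA = GA"

text \<open>The term of \<open>wN\<close> in which neither end is flipped. Its coefficient is
  \<open>1\<close>, so the signs leave no trace in it.\<close>

fun lead :: "form \<times> complex \<times> complex \<times> gen list \<Rightarrow> gen list" where
  "lead (j, \<epsilon>, \<epsilon>', f) = first_letter j # f @ [last_letter j]"

lemma letters_neq:
  "flipB (first_letter j) \<noteq> first_letter k" "flipC (last_letter j) \<noteq> last_letter k"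
  by (cases j; cases k; simp)+

lemma form_eq_iff: "j = k \<longleftrightarrow> first_letter j = first_letter k \<and> last_letter j = last_letter k"
  by (cases j; cases k; simp)

lemma signC_last_letter: "signC (last_letter j) = - 1"
  by (cases j) simp_all

lemma wN_factors:
  "wN (j, \<epsilon>, \<epsilon>', f) = (gen_elem (first_letter j) + \<epsilon> *\<^sub>C gen_elem (flipB (first_letter j)))
     * word_elem f * (gen_elem (last_letter j) + (\<i> * \<epsilon>') *\<^sub>C gen_elem (flipC (last_letter j)))"
  by (cases j) (simp_all add: gen_elem_simps)

lemma wN_words:
  "wN (j, \<epsilon>, \<epsilon>', f) = word_elem (first_letter j # f @ [last_letter j])
     + (\<i> * \<epsilon>') *\<^sub>C word_elem (first_letter j # f @ [flipC (last_letter j)])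
     + \<epsilon> *\<^sub>C word_elem (flipB (first_letter j) # f @ [last_letter j])
     + (\<epsilon> * (\<i> * \<epsilon>')) *\<^sub>C word_elem (flipB (first_letter j) # f @ [flipC (last_letter j)])"
  by (simp add: wN_factors distrib_left distrib_right mult_scaleC_left mult_scaleC_right
      scaleC_scaleC scaleC_add_right mult.assoc add_ac mult.left_commute)

lemma wN_in_W:
  assumes "length f = N - 2" "N \<ge> 2"
  shows "wN (j, \<epsilon>, \<epsilon>', f) \<in> W N"
  unfolding wN_words using assms by (intro W_closed word_in_W) simp_all

lemma wN_eigen:
  assumes "\<epsilon> \<in> signs" "\<epsilon>' \<in> signs"
  shows "eigen \<epsilon> \<epsilon>' (wN (j, \<epsilon>, \<epsilon>', f))"
proof -
  have "(\<i> * \<epsilon>') * (\<i> * \<epsilon>') = - 1"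
    using signs_square[OF assms(2)] by (simp add: mult_ac mult.left_commute[of \<epsilon>' \<i>])
  then have C: "\<pi>\<^sub>R C\<^sub>S (l * (gen_elem (last_letter j) + (\<i> * \<epsilon>') *\<^sub>C gen_elem (flipC (last_letter j))))
    = (\<i> * \<epsilon>') *\<^sub>C (l * (gen_elem (last_letter j) + (\<i> * \<epsilon>') *\<^sub>C gen_elem (flipC (last_letter j))))"
    for l
    by (simp add: distrib_left mult_scaleC_right action_linear action_C signC_last_letter
        scaleC_add_right scaleC_scaleC scaleC_one)
  have B: "\<pi>\<^sub>R B\<^sub>S ((gen_elem (first_letter j) + \<epsilon> *\<^sub>C gen_elem (flipB (first_letter j))) * r)
    = \<epsilon> *\<^sub>C ((gen_elem (first_letter j) + \<epsilon> *\<^sub>C gen_elem (flipB (first_letter j))) * r)" for r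
    using signs_square[OF assms(1)]
    by (simp add: distrib_right mult_scaleC_left action_linear action_B scaleC_add_right
        scaleC_scaleC scaleC_one add.commute)
  show ?thesis
    unfolding eigen_def wN_factors C by (simp add: B mult.assoc)
qed

text \<open>The letters \<open>a\<close> and \<open>b\<close> both exclude \<open>b\<close>,
  \<open>d\<close> as next letter; \<open>c\<close> and \<open>d\<close> both exclude
  \<open>a\<close>, \<open>c\<close>.\<close>

lemma normal_flipB: "normal (flipB x # w) \<longleftrightarrow> normal (x # w)"
  by (cases w; cases x) (auto simp: normal_def forbidden_def)

text \<open>The letters \<open>a\<close> and \<open>c\<close> both exclude \<open>c\<close>,
  \<open>d\<close> as preceding letter; \<open>b\<close> and \<open>d\<close> both exclude
  \<open>a\<close>, \<open>b\<close>.\<close>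

lemma normal_flipC: "normal (w @ [flipC x]) \<longleftrightarrow> normal (w @ [x])"
  by (cases w rule: rev_cases; cases x) (auto simp: normal_def forbidden_def successively_append_iff)

text \<open>The four words in \<open>wN_words\<close> differ only by flips at the ends, so they are
  all normal or all zero.\<close>

lemma normal_lead:
  assumes "wN i \<noteq> 0"
  shows "normal (lead i)"
proof (rule ccontr)
  obtain j \<epsilon> \<epsilon>' f where i: "i = (j, \<epsilon>, \<epsilon>', f)" by (cases i)
  define s t where "s = first_letter j" and "t = last_letter j"
  assume "\<not> normal (lead i)"
  then have n: "\<not> normal (s # f @ [t])" by (simp add: i s_def t_def)
  have "\<not> normal (s # f @ [flipC t])" 
    using n normal_flipC[of "s # f" t] by simp
  moreover have "\<not> normal (flipB s # f @ [t])"
    using n normal_flipB by blast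
  ultimately have "\<not> normal (flipB s # f @ [flipC t])"
    using normal_flipB by blast
  with n \<open>\<not> normal (s # f @ [flipC t])\<close> \<open>\<not> normal (flipB s # f @ [t])\<close> have "wN i = 0"
    unfolding i wN_words by (simp add: word_elem_eq_0 s_def t_def del: word_elem_simps)
  with assms show False by simp
qed

lemma middle_normal: "normal (x # f @ [y]) \<Longrightarrow> normal f"
  using successively_append_iff[of _ "x # f" "[y]"] by (cases f) (auto simp: normal_def)

text \<open>A lead begins and ends in \<open>a\<close> or \<open>d\<close>, whereas each other term
  of a \<open>wN\<close> has \<open>b\<close> or \<open>c\<close> at one end at least. So a lead can
  only meet another lead.\<close>

lemma wN_lead:
  assumes "normal (lead i)"
  shows "pairing (coeff (lead i)) (wN (k, \<epsilon>, \<epsilon>', g)) =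
    (if lead i = lead (k, \<epsilon>, \<epsilon>', g) then 1 else 0)"
proof (cases i)
  case (fields j \<delta> \<delta>' f)
  have "first_letter j # f @ [last_letter j] \<noteq> first_letter k # g @ [flipC (last_letter k)]"
    "first_letter j # f @ [last_letter j] \<noteq> flipB (first_letter k) # w" for w
    using letters_neq[of k j] by auto
  with assms show ?thesis
    unfolding wN_words fields
    by (simp add: clinearD[OF clinear_pairing] pairing_coeff del: word_elem_simps)
       (auto simp: letters_neq letters_neq[symmetric])
qed

lemma wN_nonzero: "normal (lead i) \<Longrightarrow> wN i \<noteq> 0"
proof
  assume "normal (lead i)" "wN i = 0"
  then show False
    using wN_lead[of i "fst i" "fst (snd i)" "fst (snd (snd i))" "snd (snd (snd i))"]
    by (simp add: clinearD[OF clinear_pairing])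
qed

lemma wN_index_iff:
  "(j, \<epsilon>, \<epsilon>', f) \<in> wN_index N \<longleftrightarrow>
     \<epsilon> \<in> signs \<and> \<epsilon>' \<in> signs \<and> length f = N - 2 \<and> normal (lead (j, \<epsilon>, \<epsilon>', f))"
  using normal_lead wN_nonzero middle_normal by (auto simp: wN_index_def)

lemma UNIV_gen: "(UNIV :: gen set) = {GA, GB, GC, GD}"
  using gen.exhaust by blast

lemma UNIV_form: "(UNIV :: form set) = {AA, DD, AD, DA}"
  using form.exhaust by blast

lemma finite_wN_index: "finite (wN_index N)"
proof (rule finite_subset)
  show "wN_index N \<subseteq> UNIV \<times> signs \<times> signs \<times> {f. set f \<subseteq> UNIV \<and> length f = N - 2}"
    by (auto simp: wN_index_def)
  show "finite ((UNIV :: form set) \<times> signs \<times> signs \<times> {f :: gen list. set f \<subseteq> UNIV \<and> length f = N - 2})"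
    by (intro finite_cartesian_product finite_lists_length_eq) (simp_all add: UNIV_gen UNIV_form signs_def)
qed

text \<open>The functionals biorthogonal to the \<open>wN\<close>: the projection separates the sign
  pairs, the coefficient of the lead separates form and middle word.\<close>

fun dual_wN :: "form \<times> complex \<times> complex \<times> gen list \<Rightarrow> S03 \<Rightarrow> complex" where
  "dual_wN (j, \<epsilon>, \<epsilon>', f) v = pairing (coeff (lead (j, \<epsilon>, \<epsilon>', f))) (proj \<epsilon> \<epsilon>' v)"

lemma clinear_dual_wN: "clinear (dual_wN i)"
  by (cases i)
     (auto intro!: clinearI simp: clinearD[OF clinear_pairing] clinearD[OF clinear_proj])

lemma dual_wN:
  assumes "i \<in> wN_index N" "k \<in> wN_index N"
  shows "dual_wN i (wN k) = (if i = k then 1 else 0)"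
proof -
  obtain j \<epsilon> \<epsilon>' f j' \<delta> \<delta>' g where i: "i = (j, \<epsilon>, \<epsilon>', f)" and k: "k = (j', \<delta>, \<delta>', g)"
    by (cases i, cases k)
  have n: "normal (lead i)" and s: "\<epsilon> \<in> signs" "\<epsilon>' \<in> signs" "\<delta> \<in> signs" "\<delta>' \<in> signs"
    using assms by (auto simp: i k wN_index_iff)
  show ?thesis
    using proj_on_eigen[OF wN_eigen[OF s(3,4), of j' g] s(3,4,1,2)] wN_lead[OF n, of j' \<delta> \<delta>' g]
    by (simp add: i k clinearD[OF clinear_pairing] form_eq_iff) auto
qed

section \<open>Spanning by projected words\<close>

lemma proj_word:
  "proj \<epsilon> \<epsilon>' (gen_elem x * g * gen_elem y) = (1 / 4) *\<^sub>C
     ((gen_elem x + \<epsilon> *\<^sub>C gen_elem (flipB x)) * g * (gen_elem y - (\<i> * \<epsilon>' * signC y) *\<^sub>C gen_elem (flipC y)))"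
proof -
  have B: "\<pi>\<^sub>R B\<^sub>S (gen_elem z * g * h) = gen_elem (flipB z) * g * h" for z h
    by (simp add: action_B mult.assoc)
  show ?thesis
    by (simp add: proj_def Let_def B action_C action_linear distrib_left distrib_right
        right_diff_distrib mult_scaleC_left mult_scaleC_right scaleC_add_right
        cvs.scale_right_diff_distrib scaleC_scaleC mult_ac[where 'a = complex] add_ac diff_diff_eq)
qed

text \<open>Flipping an end of a word only rescales the corresponding binomial factor of its
  projection, so all words of one orbit project to the same line.\<close>

lemma proj_word_wN:
  assumes "x = first_letter j \<or> x = flipB (first_letter j)"
    and "y = last_letter j \<or> y = flipC (last_letter j)"
    and "\<epsilon> \<in> signs" "\<epsilon>' \<in> signs"
  shows "\<exists>c. proj \<epsilon> \<epsilon>' (gen_elem x * word_elem f * gen_elem y) = c *\<^sub>C wN (j, \<epsilon>, \<epsilon>', f)"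
proof -
  let ?p = "gen_elem (first_letter j) + \<epsilon> *\<^sub>C gen_elem (flipB (first_letter j))"
  let ?q = "gen_elem (last_letter j) + (\<i> * \<epsilon>') *\<^sub>C gen_elem (flipC (last_letter j))"
  have "\<exists>c. gen_elem x + \<epsilon> *\<^sub>C gen_elem (flipB x) = c *\<^sub>C ?p"
    using assms(1)
  proof
    assume "x = first_letter j"
    then show ?thesis by (intro exI[of _ 1]) (simp add: scaleC_one)
  next
    assume "x = flipB (first_letter j)"
    then show ?thesis using signs_square[OF assms(3)]
      \<comment> \<open>Because \<open>\<epsilon>\<close> squares to \<open>1\<close>, the flipped
        binomial is \<open>\<epsilon>\<close> times the original.\<close>
      by (intro exI[of _ \<epsilon>]) (simp add: scaleC_add_right scaleC_scaleC scaleC_one add.commute)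
  qed
  then obtain c where c: "gen_elem x + \<epsilon> *\<^sub>C gen_elem (flipB x) = c *\<^sub>C ?p" ..
  have "\<exists>d. gen_elem y - (\<i> * \<epsilon>' * signC y) *\<^sub>C gen_elem (flipC y) = d *\<^sub>C ?q"
    using assms(2)
  proof
    assume "y = last_letter j"
    then show ?thesis by (intro exI[of _ 1]) (simp add: signC_last_letter scaleC_one)
  next
    assume y: "y = flipC (last_letter j)"
    have "(\<i> * \<epsilon>') * (\<i> * \<epsilon>') = - 1"
      using signs_square[OF assms(4)] by (simp add: mult_ac mult.left_commute[of \<epsilon>' \<i>])
    \<comment> \<open>The flipped last letter has sign \<open>1\<close>, and
      \<open>\<i> * \<epsilon>'\<close> squares to \<open>- 1\<close>; hence the factor
      \<open>- (\<i> * \<epsilon>')\<close>.\<close>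
    then show ?thesis
      by (intro exI[of _ "- (\<i> * \<epsilon>')"])
         (simp add: y signC_last_letter scaleC_add_right scaleC_scaleC scaleC_one)
  qed
  then obtain d where d: "gen_elem y - (\<i> * \<epsilon>' * signC y) *\<^sub>C gen_elem (flipC y) = d *\<^sub>C ?q" ..
  show ?thesis
    by (intro exI[of _ "(1 / 4) * (c * d)"])
       (unfold proj_word c d wN_factors, simp add: mult_scaleC_left mult_scaleC_right scaleC_scaleC
         mult_ac[where 'a = complex])
qed

text \<open>By \<open>sum_proj\<close> each word is the sum of its four projections, and each of
  these is a multiple of some \<open>wN\<close>.\<close>

lemma span_wN:
  assumes "N \<ge> 2"
  shows "W N = cvs.span (wN ` wN_index N)"
proof
  show "cvs.span (wN ` wN_index N) \<subseteq> W N"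
    using assms by (intro cvs.span_minimal subspace_W) (auto simp: wN_index_def intro!: wN_in_W)
  let ?S = "cvs.span (wN ` wN_index N)"
  have gen: "wN (j, \<epsilon>, \<epsilon>', f) \<in> ?S" if "\<epsilon> \<in> signs" "\<epsilon>' \<in> signs" "length f = N - 2" for j \<epsilon> \<epsilon>' f
  proof (cases "normal (lead (j, \<epsilon>, \<epsilon>', f))")
    case True
    then show ?thesis using that by (intro cvs.span_base imageI) (simp add: wN_index_iff)
  next
    case False
    then show ?thesis using normal_lead cvs.span_zero by metis
  qed
  have "word_elem w \<in> ?S" if w: "length w = N" for w
  proof -
    obtain x f y where f: "w = x # f @ [y]" "length f = N - 2" using long_word[OF assms w] .
    have "\<exists>j\<in>{AA, DD, AD, DA}. (x = first_letter j \<or> x = flipB (first_letter j))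
      \<and> (y = last_letter j \<or> y = flipC (last_letter j))"
      by (cases x; cases y; simp)
    then obtain j where j: "x = first_letter j \<or> x = flipB (first_letter j)"
      "y = last_letter j \<or> y = flipC (last_letter j)" by blast
    have "proj \<epsilon> \<epsilon>' (word_elem w) \<in> ?S" if signs: "\<epsilon> \<in> signs" "\<epsilon>' \<in> signs" for \<epsilon> \<epsilon>'
    proof -
      obtain c where "proj \<epsilon> \<epsilon>' (gen_elem x * word_elem f * gen_elem y) = c *\<^sub>C wN (j, \<epsilon>, \<epsilon>', f)"
        using proj_word_wN[OF j signs] by blast
      then show ?thesis using gen[OF signs f(2)] by (simp add: f(1) mult.assoc cvs.span_scale)
    qed
    then have "(\<Sum>(\<epsilon>, \<epsilon>')\<in>signs \<times> signs. proj \<epsilon> \<epsilon>' (word_elem w)) \<in> ?S"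
      by (intro cvs.span_sum) auto
    then show ?thesis by (simp only: sum_proj)
  qed
  then show "W N \<subseteq> ?S"
    unfolding W_def by (intro cvs.span_minimal) auto
qed

lemma direct_sum_wN:
  assumes "N \<ge> 2"
  shows "direct_sum (wN_index N) (\<lambda>i. cvs.span {wN i}) (W N)" "cvs.dim (W N) = card (wN_index N)"
  by (rule direct_sum_lines[OF finite_wN_index clinear_dual_wN _ span_wN[OF assms]], erule (1) dual_wN)+

lemma one_dim_rep_wN:
  assumes "N \<ge> 2" "(j, \<epsilon>, \<epsilon>', f) \<in> wN_index N"
  shows "one_dim_rep (cvs.span {wN (j, \<epsilon>, \<epsilon>', f)}) \<epsilon> \<epsilon>'"
  using assms by (intro one_dim_rep_span[OF assms(1)] wN_in_W wN_eigen) (auto simp: wN_index_def)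


section \<open>Degree two\<close>

definition index2 :: "nat \<times> complex \<times> complex \<Rightarrow> form \<times> complex \<times> complex \<times> gen list" where
  "index2 = (\<lambda>(k, \<epsilon>, \<epsilon>'). (if k = 1 then AA else DD, \<epsilon>, \<epsilon>', []))"

lemma w2_wN: "w2 i = wN (index2 i)"
  by (cases i) (simp add: w2_def index2_def)

text \<open>With an empty middle, the leads \<open>a d\<close> and \<open>d a\<close> of the mixed
  forms are forbidden, so only \<open>AA\<close> and \<open>DD\<close> remain.\<close>

lemma bij_index2: "bij_betw index2 ({1, 2} \<times> signs \<times> signs) (wN_index 2)"
proof (rule bij_betw_imageI)
  show "inj_on index2 ({1, 2} \<times> signs \<times> signs)"
    by (auto simp: inj_on_def index2_def split: if_splits)
  have "(j, \<epsilon>, \<epsilon>', f) \<in> wN_index 2 \<longleftrightarrow>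
      (j, \<epsilon>, \<epsilon>', f) \<in> index2 ` ({1, 2} \<times> signs \<times> signs)" for j \<epsilon> \<epsilon>' f
    by (cases j) (auto simp: wN_index_iff index2_def image_iff normal_def forbidden_def)
  then show "index2 ` ({1, 2} \<times> signs \<times> signs) = wN_index 2"
    unfolding set_eq_iff split_paired_All by blast
qed

lemma direct_sum_w2:
  "direct_sum ({1, 2} \<times> signs \<times> signs) (\<lambda>i. cvs.span {w2 i}) (W 2)" "cvs.dim (W 2) = 8"
proof -
  let ?I = "{1, 2 :: nat} \<times> signs \<times> signs"
  have mem: "index2 i \<in> wN_index 2" if "i \<in> ?I" for i
    using bij_index2 that by (auto simp: bij_betw_def)
  have inj: "index2 i = index2 k \<longleftrightarrow> i = k" if "i \<in> ?I" "k \<in> ?I" for i k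
    using bij_index2 that by (auto simp: bij_betw_def inj_on_def)
  have fin: "finite ?I" by (simp add: signs_def)
  have dual: "dual_wN (index2 i) (w2 k) = (if i = k then 1 else 0)" if "i \<in> ?I" "k \<in> ?I" for i k
    unfolding w2_wN using dual_wN[OF mem mem] inj that by simp
  have span: "W 2 = cvs.span (w2 ` ?I)"
    using bij_index2 span_wN[of 2] by (simp add: w2_wN image_comp[symmetric] comp_def bij_betw_def flip: image_image)
  show "direct_sum ?I (\<lambda>i. cvs.span {w2 i}) (W 2)"
    by (rule direct_sum_lines(1)[OF fin clinear_dual_wN dual span])
  have "cvs.dim (W 2) = card ?I"
    by (rule direct_sum_lines(2)[OF fin clinear_dual_wN dual span])
  then show "cvs.dim (W 2) = 8" by (simp add: signs_def card_cartesian_product)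
qed

lemma one_dim_rep_w2:
  assumes "k \<in> {1, 2}" "\<epsilon> \<in> signs" "\<epsilon>' \<in> signs"
  shows "one_dim_rep (cvs.span {w2 (k, \<epsilon>, \<epsilon>')}) \<epsilon> \<epsilon>'"
proof -
  have "index2 (k, \<epsilon>, \<epsilon>') \<in> wN_index 2"
    using bij_index2 assms unfolding bij_betw_def by blast
  then show ?thesis
    using one_dim_rep_wN[of 2 _ \<epsilon> \<epsilon>' "[]"] by (simp add: w2_wN index2_def)
qed


section \<open>Irreducible subrepresentations in degree at least two\<close>

lemma has_character_unique:
  assumes "has_character U \<epsilon> \<epsilon>'" "has_character U \<delta> \<delta>'" "U \<noteq> {0}" "U \<noteq> {}"
  shows "\<epsilon> = \<delta> \<and> \<epsilon>' = \<delta>'"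
proof -
  obtain u where "u \<in> U" "u \<noteq> 0" using assms(3,4) by blast
  then have "\<epsilon> *\<^sub>C u = \<delta> *\<^sub>C u" "(\<i> * \<epsilon>') *\<^sub>C u = (\<i> * \<delta>') *\<^sub>C u"
    using assms(1,2) by (metis has_character_def acts_as_def)+
  then show ?thesis using \<open>u \<noteq> 0\<close> by (simp add: cvs.scale_cancel_right)
qed

lemma irreps_in_one_dim:
  assumes "N \<ge> 2" "U \<in> irreps_in N"
  obtains \<epsilon> \<epsilon>' v where "\<epsilon> \<in> signs" "\<epsilon>' \<in> signs" "v \<in> W N" "v \<noteq> 0" "eigen \<epsilon> \<epsilon>' v" "U = cvs.span {v}"
proof -
  have U: "subrep U" "U \<noteq> {0}" "U \<subseteq> W N" "cvs.subspace U"
    and irr: "\<And>V. subrep V \<Longrightarrow> V \<subseteq> U \<Longrightarrow> V = {0} \<or> V = U"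
    using assms(2) by (auto simp: irreps_in_def irreducible_rep_def subrep_def)
  obtain u where u: "u \<in> U" "u \<noteq> 0" using U(2) cvs.subspace_0[OF U(4)] by blast
  have "\<exists>\<epsilon>\<in>signs. \<exists>\<epsilon>'\<in>signs. proj \<epsilon> \<epsilon>' u \<noteq> 0"
  proof (rule ccontr)
    assume "\<not> ?thesis"
    then have "(\<Sum>(\<epsilon>, \<epsilon>')\<in>signs \<times> signs. proj \<epsilon> \<epsilon>' u) = 0" by (intro sum.neutral) auto
    then show False using u(2) by (simp add: sum_proj)
  qed
  then obtain \<epsilon> \<epsilon>' where e: "\<epsilon> \<in> signs" "\<epsilon>' \<in> signs" and v: "proj \<epsilon> \<epsilon>' u \<noteq> 0" by blast
  have "\<pi>\<^sub>R B\<^sub>S x \<in> U" "\<pi>\<^sub>R C\<^sub>S x \<in> U" if "x \<in> U" for x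
    using U(1) that s03.B s03.C by (auto simp: subrep_def)
  note closed = this cvs.subspace_scale[OF U(4)] cvs.subspace_diff[OF U(4)] cvs.subspace_add[OF U(4)]
  have vU: "proj \<epsilon> \<epsilon>' u \<in> U"
    unfolding proj_def Let_def by (intro closed u(1))
  have eig: "eigen \<epsilon> \<epsilon>' (proj \<epsilon> \<epsilon>' u)"
    using u(1) U(3) by (intro proj_eigen[OF assms(1) _ e]) blast
  have vW: "proj \<epsilon> \<epsilon>' u \<in> W N" using vU U(3) by blast
  have "subrep (cvs.span {proj \<epsilon> \<epsilon>' u})"
    using one_dim_rep_span[OF assms(1) vW v eig] by (simp add: one_dim_rep_def)
  moreover have "cvs.span {proj \<epsilon> \<epsilon>' u} \<subseteq> U"
    using vU U(4) by (intro cvs.span_minimal) auto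
  moreover have "cvs.span {proj \<epsilon> \<epsilon>' u} \<noteq> {0}"
    using v cvs.span_base[of "proj \<epsilon> \<epsilon>' u" "{proj \<epsilon> \<epsilon>' u}"] by auto
  ultimately have "U = cvs.span {proj \<epsilon> \<epsilon>' u}" using irr by blast
  then show thesis using that e vW v eig by blast
qed

lemma irreps_inI:
  assumes "N \<ge> 2" "v \<in> W N" "v \<noteq> 0" "eigen \<epsilon> \<epsilon>' v"
  shows "cvs.span {v} \<in> irreps_in N"
proof -
  have "subrep (cvs.span {v})"
    using one_dim_rep_span[OF assms] by (simp add: one_dim_rep_def)
  moreover have "cvs.span {v} \<subseteq> W N"
    using assms(2) subspace_W by (intro cvs.span_minimal) auto
  ultimately show ?thesis using irreducible_span assms(3) by (simp add: irreps_in_def)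
qed

lemma irreps_in_nonempty:
  assumes "N \<ge> 2" "\<epsilon> \<in> signs" "\<epsilon>' \<in> signs"
  shows "\<exists>U\<in>irreps_in N. has_character U \<epsilon> \<epsilon>'"
proof -
  \<comment> \<open>The lead of this vector is \<open>a^N\<close>, normal in every degree and for
    all signs, so each sign pair occurs.\<close>
  define i where "i = (AA, \<epsilon>, \<epsilon>', replicate (N - 2) GA)"
  have "lead i = replicate N GA"
    using assms(1) by (simp add: i_def replicate_append_same flip: replicate_Suc)
  then have "i \<in> wN_index N"
    using assms normal_replicate[of N] by (simp add: i_def wN_index_iff)
  then have i: "wN i \<noteq> 0" "wN i \<in> W N" "eigen \<epsilon> \<epsilon>' (wN i)"
    using assms by (auto simp: i_def wN_index_def intro!: wN_eigen wN_in_W simp del: wN.simps)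
  have "has_character (cvs.span {wN i}) \<epsilon> \<epsilon>'"
    using one_dim_rep_span[OF assms(1) i(2,1,3)] unfolding one_dim_rep_def by blast
  then show ?thesis using irreps_inI[OF assms(1) i(2,1,3)] by blast
qed

section \<open>Isomorphism classes\<close>

lemma isomorphic_rep_has_character:
  assumes "isomorphic_rep U V" "has_character U \<epsilon> \<epsilon>'"
  shows "has_character V \<epsilon> \<epsilon>'"
proof -
  obtain \<phi> where bij: "bij_betw \<phi> U V"
    and scale: "\<And>c f. f \<in> U \<Longrightarrow> \<phi> (c *\<^sub>C f) = c *\<^sub>C \<phi> f"
    and equivariant: "\<And>Z f. Z \<in> s03 \<Longrightarrow> f \<in> U \<Longrightarrow> \<phi> (\<pi>\<^sub>R Z f) = \<pi>\<^sub>R Z (\<phi> f)"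
    using assms(1) unfolding isomorphic_rep_def by blast
  have "acts_as Z c V" if "Z \<in> s03" "acts_as Z c U" for Z c
    unfolding acts_as_def
  proof
    fix g
    assume "g \<in> V"
    then obtain f where f: "f \<in> U" "g = \<phi> f" using bij by (auto simp: bij_betw_def)
    have "\<pi>\<^sub>R Z f = c *\<^sub>C f" using that(2) f(1) by (simp add: acts_as_def)
    then show "\<pi>\<^sub>R Z g = c *\<^sub>C g" using equivariant[OF that(1) f(1)] scale[OF f(1)] f(2) by simp
  qed
  then show ?thesis
    using assms(2) s03.B s03.C s03.D by (simp add: has_character_def)
qed

text \<open>By \<open>s03_scalar\<close> each \<open>Z\<close> multiplies \<open>u\<close> and
  \<open>v\<close> by the same number, so the linear map sending \<open>u\<close> to
  \<open>v\<close> is equivariant.\<close>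

lemma isomorphic_rep_lines:
  assumes "N \<ge> 2" "u \<in> W N" "u \<noteq> 0" "eigen \<epsilon> \<epsilon>' u" "v \<in> W N" "v \<noteq> 0" "eigen \<epsilon> \<epsilon>' v"
  shows "isomorphic_rep (cvs.span {u}) (cvs.span {v})"
proof -
  define \<phi> where "\<phi> f = (THE c. f = c *\<^sub>C u) *\<^sub>C v" for f
  have \<phi>: "\<phi> (c *\<^sub>C u) = c *\<^sub>C v" for c
    using assms(3) by (simp add: \<phi>_def cvs.scale_cancel_right)
  have "bij_betw \<phi> (cvs.span {u}) (cvs.span {v})"
    unfolding bij_betw_def span_singleton
    using assms(6) by (auto simp: inj_on_def \<phi> image_image cvs.scale_cancel_right)
  moreover have "\<phi> (\<pi>\<^sub>R Z (c *\<^sub>C u)) = \<pi>\<^sub>R Z (\<phi> (c *\<^sub>C u))" if Z: "Z \<in> s03" for Z c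
  proof -
    obtain d where "\<pi>\<^sub>R Z u = d *\<^sub>C u" "\<pi>\<^sub>R Z v = d *\<^sub>C v"
      using s03_scalar[OF Z assms(1), of \<epsilon> \<epsilon>'] assms by blast
    then show ?thesis by (simp add: \<phi> action_linear scaleC_scaleC)
  qed
  ultimately show ?thesis
    unfolding isomorphic_rep_def
    by (intro exI[of _ \<phi>])
       (auto simp: span_singleton \<phi> scaleC_scaleC simp flip: scaleC_add_left)
qed

lemma irreps_in_character:
  assumes "N \<ge> 2" "U \<in> irreps_in N"
  obtains \<epsilon> \<epsilon>' where "\<epsilon> \<in> signs" "\<epsilon>' \<in> signs" "one_dim_rep U \<epsilon> \<epsilon>'"
    "\<And>\<delta> \<delta>'. has_character U \<delta> \<delta>' \<longleftrightarrow> \<delta> = \<epsilon> \<and> \<delta>' = \<epsilon>'"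
proof -
  obtain \<epsilon> \<epsilon>' v where v: "\<epsilon> \<in> signs" "\<epsilon>' \<in> signs" "v \<in> W N" "v \<noteq> 0" "eigen \<epsilon> \<epsilon>' v" "U = cvs.span {v}"
    using irreps_in_one_dim[OF assms] .
  have o: "one_dim_rep U \<epsilon> \<epsilon>'" using one_dim_rep_span[OF assms(1) v(3-5)] v(6) by simp
  have "v \<in> U" using v(6) cvs.span_base[of v "{v}"] by simp
  then have "U \<noteq> {0}" "U \<noteq> {}" using v(4) by auto
  then show thesis
    using that[OF v(1,2) o] has_character_unique o unfolding one_dim_rep_def by blast
qed

lemma isomorphic_iff_character:
  assumes "N \<ge> 2" "U \<in> irreps_in N" "V \<in> irreps_in N"
  shows "isomorphic_rep U V \<longleftrightarrow> (\<forall>\<delta> \<delta>'. has_character U \<delta> \<delta>' \<longleftrightarrow> has_character V \<delta> \<delta>')"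
proof
  assume iso: "isomorphic_rep U V"
  obtain \<epsilon> \<epsilon>' where e: "\<And>\<delta> \<delta>'. has_character U \<delta> \<delta>' \<longleftrightarrow> \<delta> = \<epsilon> \<and> \<delta>' = \<epsilon>'"
    using irreps_in_character[OF assms(1,2)] by metis
  moreover obtain \<eta> \<eta>' where "\<And>\<delta> \<delta>'. has_character V \<delta> \<delta>' \<longleftrightarrow> \<delta> = \<eta> \<and> \<delta>' = \<eta>'"
    using irreps_in_character[OF assms(1,3)] by metis
  moreover have "has_character V \<epsilon> \<epsilon>'" using isomorphic_rep_has_character[OF iso] e by blast
  ultimately show "\<forall>\<delta> \<delta>'. has_character U \<delta> \<delta>' \<longleftrightarrow> has_character V \<delta> \<delta>'" by simp
next
  assume eq: "\<forall>\<delta> \<delta>'. has_character U \<delta> \<delta>' \<longleftrightarrow> has_character V \<delta> \<delta>'"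
  obtain \<epsilon> \<epsilon>' u where u: "u \<in> W N" "u \<noteq> 0" "eigen \<epsilon> \<epsilon>' u" "U = cvs.span {u}"
    using irreps_in_one_dim[OF assms(1,2)] by metis
  obtain \<eta> \<eta>' v where v: "v \<in> W N" "v \<noteq> 0" "eigen \<eta> \<eta>' v" "V = cvs.span {v}"
    using irreps_in_one_dim[OF assms(1,3)] by metis
  have "has_character U \<epsilon> \<epsilon>'" 
    using one_dim_rep_span[OF assms(1) u(1-3)] u(4) by (simp add: one_dim_rep_def)
  then have "has_character V \<epsilon> \<epsilon>'" using eq by blast
  moreover have "v \<in> V" using v(4) cvs.span_base[of v "{v}"] by simp
  \<comment> \<open>The vector \<open>v\<close> came with signs of its own; as a member of
    \<open>V\<close> it also has those of \<open>U\<close>, the common pair that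
    \<open>isomorphic_rep_lines\<close> asks for.\<close>
  ultimately have "eigen \<epsilon> \<epsilon>' v"
    by (simp add: has_character_def acts_as_def eigen_def)
  then show "isomorphic_rep U V"
    unfolding u(4) v(4) using isomorphic_rep_lines[OF assms(1) u(1-3) v(1,2)] by blast
qed

text \<open>By \<open>isomorphic_iff_character\<close> isomorphism means equal characters, so the
  classes are the fibres of the character, and each pair of signs has a nonempty fibre.\<close>

lemma iso_classes:
  assumes "N \<ge> 2"
  shows "equiv (irreps_in N) (iso_rel N)"
    "bij_betw (\<lambda>(\<epsilon>, \<epsilon>'). {U \<in> irreps_in N. has_character U \<epsilon> \<epsilon>'})
        (signs \<times> signs) (irreps_in N // iso_rel N)"
proof -
  have iso: "(U, V) \<in> iso_rel N \<longleftrightarrow> U \<in> irreps_in N \<and> V \<in> irreps_in N \<and>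
      (\<forall>\<delta> \<delta>'. has_character U \<delta> \<delta>' \<longleftrightarrow> has_character V \<delta> \<delta>')" for U V
    using isomorphic_iff_character[OF assms] by (auto simp: iso_rel_def)
  show "equiv (irreps_in N) (iso_rel N)"
    unfolding equiv_def refl_on_def sym_def trans_def using iso by (simp add: subset_iff)
  let ?F = "\<lambda>(\<epsilon>, \<epsilon>'). {U \<in> irreps_in N. has_character U \<epsilon> \<epsilon>'}"
  have cls: "iso_rel N `` {U} = ?F (\<epsilon>, \<epsilon>')" if U: "U \<in> irreps_in N" "has_character U \<epsilon> \<epsilon>'" for U \<epsilon> \<epsilon>'
  proof -
    obtain \<eta> \<eta>' where u: "\<And>\<delta> \<delta>'. has_character U \<delta> \<delta>' \<longleftrightarrow> \<delta> = \<eta> \<and> \<delta>' = \<eta>'"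
      using irreps_in_character[OF assms U(1)] by metis
    have "(U, V) \<in> iso_rel N \<longleftrightarrow> V \<in> irreps_in N \<and> has_character V \<epsilon> \<epsilon>'" for V
    proof (cases "V \<in> irreps_in N")
      case True
      obtain \<zeta> \<zeta>' where "\<And>\<delta> \<delta>'. has_character V \<delta> \<delta>' \<longleftrightarrow> \<delta> = \<zeta> \<and> \<delta>' = \<zeta>'"
        using irreps_in_character[OF assms True] by metis
      then show ?thesis using U u unfolding iso by auto
    qed (simp add: iso)
    then show ?thesis by auto
  qed
  show "bij_betw ?F (signs \<times> signs) (irreps_in N // iso_rel N)"
  proof (rule bij_betw_imageI)
    show "inj_on ?F (signs \<times> signs)"
    proof (rule inj_onI)
      fix p q
      assume p: "p \<in> signs \<times> signs" and q: "q \<in> signs \<times> signs" and F: "?F p = ?F q"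
      obtain U where U: "U \<in> irreps_in N" "has_character U (fst p) (snd p)"
        using irreps_in_nonempty[OF assms, of "fst p" "snd p"] p by (auto simp: mem_Times_iff)
      then have "U \<in> ?F q" using F by (auto simp: case_prod_unfold)
      then have "has_character U (fst q) (snd q)" by (auto simp: case_prod_unfold)
      moreover obtain \<eta> \<eta>' where "\<And>\<delta> \<delta>'. has_character U \<delta> \<delta>' \<longleftrightarrow> \<delta> = \<eta> \<and> \<delta>' = \<eta>'"
        using irreps_in_character[OF assms U(1)] by metis
      ultimately show "p = q" using U(2) by (simp add: prod_eq_iff)
    qed
    show "?F ` (signs \<times> signs) = irreps_in N // iso_rel N"
    proof (intro equalityI subsetI)
      fix X
      assume "X \<in> ?F ` (signs \<times> signs)"
      then obtain \<epsilon> \<epsilon>' where e: "\<epsilon> \<in> signs" "\<epsilon>' \<in> signs" "X = ?F (\<epsilon>, \<epsilon>')" by auto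
      then obtain U where "U \<in> irreps_in N" "has_character U \<epsilon> \<epsilon>'"
        using irreps_in_nonempty[OF assms] by blast
      then show "X \<in> irreps_in N // iso_rel N"
        using cls[of U \<epsilon> \<epsilon>'] quotientI[of U "irreps_in N" "iso_rel N"] e(3) by simp
    next
      fix X
      assume "X \<in> irreps_in N // iso_rel N"
      then obtain U where U: "U \<in> irreps_in N" "X = iso_rel N `` {U}" by (auto simp: quotient_def)
      obtain \<epsilon> \<epsilon>' where "\<epsilon> \<in> signs" "\<epsilon>' \<in> signs" "has_character U \<epsilon> \<epsilon>'"
        using irreps_in_character[OF assms U(1)] by (metis one_dim_rep_def)
      then show "X \<in> ?F ` (signs \<times> signs)" using cls[OF U(1)] U(2) by blast
    qed
  qed
qed

section \<open>Degrees zero and one\<close>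

lemma W_0: "W 0 = cvs.span {1}"
proof -
  have "{word_elem w |w. normal w \<and> length w = 0} = {1}"
    by (auto simp: normal_Nil)
  then show ?thesis by (simp add: W_def)
qed

lemma acts_on_W_0:
  "acts_as A\<^sub>S 0 (W 0)" "acts_as B\<^sub>S 0 (W 0)" "acts_as C\<^sub>S 0 (W 0)" "acts_as D\<^sub>S 0 (W 0)"
  unfolding W_0 acts_as_def span_singleton
  by (auto simp: action_linear action_generators_one)

section \<open>Degree one: two copies of a two-dimensional representation\<close>

lemma W_1: "W 1 = cvs.span (range gen_elem)"
proof -
  have "{word_elem w |w. normal w \<and> length w = 1} = range gen_elem"
  proof (intro equalityI subsetI)
    fix f
    assume "f \<in> range gen_elem"
    then obtain x where "f = gen_elem x" by blast
    then have "f = word_elem [x] \<and> normal [x] \<and> length [x] = 1" by (simp add: normal_def)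
    then show "f \<in> {word_elem w |w. normal w \<and> length w = 1}" by blast
  qed (auto simp: length_Suc_conv)
  then show ?thesis by (simp add: W_def)
qed

lemma coeff_gen_elem: "pairing (coeff [x]) (gen_elem y) = (if x = y then 1 else 0)"
  using pairing_coeff[of "[x]" "[y]"] by (auto simp: normal_def)

lemmas coeff_gens [simp] =
  coeff_gen_elem[of _ GA, unfolded gen_elem_simps] coeff_gen_elem[of _ GB, unfolded gen_elem_simps]
  coeff_gen_elem[of _ GC, unfolded gen_elem_simps] coeff_gen_elem[of _ GD, unfolded gen_elem_simps]

lemma dim_W_1: "cvs.dim (W 1) = 4"
proof -
  have "cvs.dim (W 1) = card (UNIV :: gen set)"
    by (rule direct_sum_lines(2)[where v = gen_elem and \<Lambda> = "\<lambda>x. pairing (coeff [x])"])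
       (simp_all add: UNIV_gen clinear_pairing coeff_gen_elem W_1[unfolded UNIV_gen]
         del: One_nat_def)
  then show ?thesis by (simp add: UNIV_gen)
qed

lemma action_gens:
  "\<pi>\<^sub>R Z a\<^sub>S = pairing Z a\<^sub>S *\<^sub>C a\<^sub>S + pairing Z b\<^sub>S *\<^sub>C b\<^sub>S - pairing Z c\<^sub>S *\<^sub>C c\<^sub>S + pairing Z d\<^sub>S *\<^sub>C d\<^sub>S"
  "\<pi>\<^sub>R Z b\<^sub>S = pairing Z b\<^sub>S *\<^sub>C a\<^sub>S + pairing Z a\<^sub>S *\<^sub>C b\<^sub>S - pairing Z d\<^sub>S *\<^sub>C c\<^sub>S + pairing Z c\<^sub>S *\<^sub>C d\<^sub>S"
  "\<pi>\<^sub>R Z c\<^sub>S = pairing Z c\<^sub>S *\<^sub>C a\<^sub>S + pairing Z a\<^sub>S *\<^sub>C c\<^sub>S - pairing Z d\<^sub>S *\<^sub>C b\<^sub>S + pairing Z b\<^sub>S *\<^sub>C d\<^sub>S"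
  "\<pi>\<^sub>R Z d\<^sub>S = pairing Z d\<^sub>S *\<^sub>C a\<^sub>S + pairing Z a\<^sub>S *\<^sub>C d\<^sub>S - pairing Z c\<^sub>S *\<^sub>C b\<^sub>S + pairing Z b\<^sub>S *\<^sub>C c\<^sub>S"
  by (simp_all add: \<pi>\<^sub>R_def coproduct_generators clinearD[OF clinear_contract_right]
      contract_right_tensor)

lemma span_pair: "x \<in> cvs.span {u, v :: S03} \<longleftrightarrow> (\<exists>p q. x = p *\<^sub>C u + q *\<^sub>C v)"
  unfolding cvs.span_breakdown_eq cvs.span_empty singleton_iff
  by (simp add: diff_eq_eq add.commute)

lemma w1_action:
  assumes "k \<in> {1, 2}"
  shows "\<pi>\<^sub>R B\<^sub>S (w1_even k) = w1_odd k" "\<pi>\<^sub>R B\<^sub>S (w1_odd k) = w1_even k"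
    "\<pi>\<^sub>R C\<^sub>S (w1_even k) = - w1_odd k" "\<pi>\<^sub>R C\<^sub>S (w1_odd k) = w1_even k"
    "\<pi>\<^sub>R D\<^sub>S (w1_even k) = w1_even k" "\<pi>\<^sub>R D\<^sub>S (w1_odd k) = - w1_odd k"
proof -
  have B: "\<pi>\<^sub>R B\<^sub>S a\<^sub>S = b\<^sub>S" "\<pi>\<^sub>R B\<^sub>S b\<^sub>S = a\<^sub>S" "\<pi>\<^sub>R B\<^sub>S c\<^sub>S = d\<^sub>S" "\<pi>\<^sub>R B\<^sub>S d\<^sub>S = c\<^sub>S"
    using action_B[of GA 1] action_B[of GB 1] action_B[of GC 1] action_B[of GD 1]
    by (simp_all add: gen_elem_simps)
  have C: "\<pi>\<^sub>R C\<^sub>S a\<^sub>S = - c\<^sub>S" "\<pi>\<^sub>R C\<^sub>S b\<^sub>S = d\<^sub>S" "\<pi>\<^sub>R C\<^sub>S c\<^sub>S = a\<^sub>S" "\<pi>\<^sub>R C\<^sub>S d\<^sub>S = - b\<^sub>S"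
    using action_C[of 1 GA] action_C[of 1 GB] action_C[of 1 GC] action_C[of 1 GD]
    by (simp_all add: gen_elem_simps scaleC_one)
  have D: "\<pi>\<^sub>R D\<^sub>S a\<^sub>S = d\<^sub>S" "\<pi>\<^sub>R D\<^sub>S b\<^sub>S = - c\<^sub>S" "\<pi>\<^sub>R D\<^sub>S c\<^sub>S = - b\<^sub>S" "\<pi>\<^sub>R D\<^sub>S d\<^sub>S = a\<^sub>S"
    using action_D[of 1] by (simp_all add: action_coeff_Nil)
  show "\<pi>\<^sub>R B\<^sub>S (w1_even k) = w1_odd k" "\<pi>\<^sub>R B\<^sub>S (w1_odd k) = w1_even k"
    "\<pi>\<^sub>R C\<^sub>S (w1_even k) = - w1_odd k" "\<pi>\<^sub>R C\<^sub>S (w1_odd k) = w1_even k"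
    "\<pi>\<^sub>R D\<^sub>S (w1_even k) = w1_even k" "\<pi>\<^sub>R D\<^sub>S (w1_odd k) = - w1_odd k"
    using assms by (auto simp: w1_even_def w1_odd_def action_linear B C D)
qed

lemma w1_combination_zero:
  assumes "p *\<^sub>C w1_even 1 + q *\<^sub>C w1_odd 1 + (r *\<^sub>C w1_even 2 + s *\<^sub>C w1_odd 2) = 0"
  shows "p = 0" "q = 0" "r = 0" "s = 0"
proof -
  have "pairing (coeff [x])
      (p *\<^sub>C w1_even 1 + q *\<^sub>C w1_odd 1 + (r *\<^sub>C w1_even 2 + s *\<^sub>C w1_odd 2)) = 0" for x
    unfolding assms by (simp add: clinearD[OF clinear_pairing])
  from this[of GA] this[of GB] this[of GC] this[of GD]
  have "p + s = 0" "p - s = 0" "q + r = 0" "q - r = 0"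
    by (simp_all add: w1_even_def w1_odd_def clinearD[OF clinear_pairing] scaleC_complex_def)
  then show "p = 0" "q = 0" "r = 0" "s = 0" by (auto simp: add_eq_0_iff)
qed

lemma w1_independent:
  assumes "k \<in> {1, 2}"
  shows "cvs.independent {w1_even k, w1_odd k}" "w1_even k \<noteq> w1_odd k"
    "cvs.dim (cvs.span {w1_even k, w1_odd k}) = 2"
proof -
  have zero: "p = 0 \<and> q = 0" if "p *\<^sub>C w1_even k + q *\<^sub>C w1_odd k = 0" for p q
    using assms that w1_combination_zero[of p q 0 0] w1_combination_zero[of 0 0 p q] by auto
  show neq: "w1_even k \<noteq> w1_odd k"
    using zero[of 1 "- 1"] by (auto simp: scaleC_one)
  have "w1_even k \<notin> cvs.span {w1_odd k}"
  proof
    assume "w1_even k \<in> cvs.span {w1_odd k}"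
    then obtain c where "w1_even k = c *\<^sub>C w1_odd k" by (auto simp: span_singleton)
    then show False using zero[of 1 "- c"] by (simp add: scaleC_one)
  qed
  moreover have "w1_odd k \<noteq> 0" using zero[of 0 1] by auto
  ultimately show indep: "cvs.independent {w1_even k, w1_odd k}"
    using neq by (simp add: cvs.independent_insert)
  show "cvs.dim (cvs.span {w1_even k, w1_odd k}) = 2"
    using neq indep by (simp add: cvs.dim_eq_card_independent)
qed

text \<open>The witnesses are the entries of the 2 by 2 matrix of \<open>Z\<close>, obtained by
  adding or subtracting the formulas of \<open>action_gens\<close>. The same entries serve both
  \<open>k\<close>, in line with \<open>isomorphic_w1\<close>.\<close>

lemma subrep_w1:
  assumes "k \<in> {1, 2}"
  shows "subrep (cvs.span {w1_even k, w1_odd k})"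
proof -
  have "\<exists>p q. \<pi>\<^sub>R Z (w1_even k) = p *\<^sub>C w1_even k + q *\<^sub>C w1_odd k" for Z
  proof (cases "k = 1")
    case True
    then show ?thesis
      by (intro exI[of _ "pairing Z a\<^sub>S + pairing Z d\<^sub>S"] exI[of _ "pairing Z b\<^sub>S - pairing Z c\<^sub>S"])
         (simp add: w1_even_def w1_odd_def action_linear action_gens scaleC_add_left scaleC_add_right
           cvs.scale_left_diff_distrib)
  next
    case False
    then show ?thesis
      by (intro exI[of _ "pairing Z a\<^sub>S + pairing Z d\<^sub>S"] exI[of _ "pairing Z b\<^sub>S - pairing Z c\<^sub>S"])
         (simp add: w1_even_def w1_odd_def action_linear action_gens scaleC_add_left
           cvs.scale_right_diff_distrib cvs.scale_left_diff_distrib)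
  qed
  moreover have "\<exists>p q. \<pi>\<^sub>R Z (w1_odd k) = p *\<^sub>C w1_even k + q *\<^sub>C w1_odd k" for Z
  proof (cases "k = 1")
    case True
    then show ?thesis
      by (intro exI[of _ "pairing Z b\<^sub>S + pairing Z c\<^sub>S"] exI[of _ "pairing Z a\<^sub>S - pairing Z d\<^sub>S"])
         (simp add: w1_even_def w1_odd_def action_linear action_gens scaleC_add_left scaleC_add_right
           cvs.scale_left_diff_distrib)
  next
    case False
    then show ?thesis
      by (intro exI[of _ "pairing Z b\<^sub>S + pairing Z c\<^sub>S"] exI[of _ "pairing Z a\<^sub>S - pairing Z d\<^sub>S"])
         (simp add: w1_even_def w1_odd_def action_linear action_gens scaleC_add_left
           cvs.scale_right_diff_distrib cvs.scale_left_diff_distrib)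
  qed
  ultimately have gens: "\<pi>\<^sub>R Z (w1_even k) \<in> cvs.span {w1_even k, w1_odd k}"
    "\<pi>\<^sub>R Z (w1_odd k) \<in> cvs.span {w1_even k, w1_odd k}" for Z
    by (simp_all add: span_pair)
  have "\<pi>\<^sub>R Z f \<in> cvs.span {w1_even k, w1_odd k}" if f: "f \<in> cvs.span {w1_even k, w1_odd k}" for Z f
  proof -
    obtain p q where "f = p *\<^sub>C w1_even k + q *\<^sub>C w1_odd k" using f span_pair by blast
    then show ?thesis using gens[of Z] by (simp add: action_linear cvs.span_add cvs.span_scale)
  qed
  then show ?thesis by (simp add: subrep_def)
qed

lemma irreducible_w1:
  assumes "k \<in> {1, 2}"
  shows "irreducible_rep (cvs.span {w1_even k, w1_odd k})"
  unfolding irreducible_rep_def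
proof (intro conjI allI impI)
  let ?u = "w1_even k" and ?v = "w1_odd k"
  show "subrep (cvs.span {?u, ?v})" by (rule subrep_w1[OF assms])
  show "cvs.span {?u, ?v} \<noteq> {0}"
    using cvs.span_base[of ?u "{?u, ?v}"] cvs.dependent_zero[of "{?u, ?v}"]
      w1_independent(1)[OF assms] by auto
  fix V
  assume V: "subrep V \<and> V \<subseteq> cvs.span {?u, ?v}"
  then have sub: "cvs.subspace V" and closed: "\<And>Z f. Z \<in> s03 \<Longrightarrow> f \<in> V \<Longrightarrow> \<pi>\<^sub>R Z f \<in> V"
    by (auto simp: subrep_def)
  show "V = {0} \<or> V = cvs.span {?u, ?v}"
  proof (cases "V \<subseteq> {0}")
    case True
    then show ?thesis using cvs.subspace_0[OF sub] by blast
  next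
    case False
    then obtain x where x: "x \<in> V" "x \<noteq> 0" by blast
    then obtain p q where pq: "x = p *\<^sub>C ?u + q *\<^sub>C ?v" using V span_pair by blast
    \<comment> \<open>On the two basis vectors \<open>D\<^sub>S\<close> has the eigenvalues 1 and
      -1, so adding this vector to \<open>x\<close> or subtracting it isolates one
      component.\<close>
    have Dx: "p *\<^sub>C ?u - q *\<^sub>C ?v \<in> V"
      using closed[OF s03.D x(1)] by (simp add: pq action_linear w1_action[OF assms])
    have "(1 / (2 * p)) *\<^sub>C (x + (p *\<^sub>C ?u - q *\<^sub>C ?v)) = ?u" if "p \<noteq> 0"
      using that by (simp add: pq scaleC_scaleC scaleC_one flip: scaleC_add_left)
    then have u: "?u \<in> V" if "p \<noteq> 0"
      using that cvs.subspace_scale[OF sub cvs.subspace_add[OF sub x(1) Dx]] by metis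
    have "(1 / (2 * q)) *\<^sub>C (x - (p *\<^sub>C ?u - q *\<^sub>C ?v)) = ?v" if "q \<noteq> 0"
      using that by (simp add: pq scaleC_scaleC scaleC_one flip: scaleC_add_left)
    then have v: "?v \<in> V" if "q \<noteq> 0"
      using that cvs.subspace_scale[OF sub cvs.subspace_diff[OF sub x(1) Dx]] by metis
    have "p \<noteq> 0 \<or> q \<noteq> 0" using x(2) pq by auto
    then have "?u \<in> V \<or> ?v \<in> V" using u v by blast
    \<comment> \<open>\<open>B\<^sub>S\<close> exchanges the basis vectors, so either one brings in
      the other.\<close>
    then have "{?u, ?v} \<subseteq> V"
      using closed[OF s03.B, of ?u] closed[OF s03.B, of ?v] w1_action[OF assms] by auto
    then have "cvs.span {?u, ?v} \<subseteq> V" by (intro cvs.span_minimal sub)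
    then show ?thesis using V by blast
  qed
qed

lemma direct_sum_w1: "direct_sum {1, 2} (\<lambda>k. cvs.span {w1_even k, w1_odd k}) (W 1)"
proof -
  let ?U = "\<lambda>k. cvs.span {w1_even k, w1_odd k}"
  let ?S = "{w1_even 1, w1_odd 1, w1_even 2, w1_odd 2}"
  have gens: "range gen_elem = {a\<^sub>S, b\<^sub>S, c\<^sub>S, d\<^sub>S}" by (simp add: UNIV_gen gen_elem_simps)
  have half: "(1 / 2) *\<^sub>C (f + f) = f" for f :: S03
    unfolding scaleC_add_right scaleC_add_left[symmetric] by (simp add: scaleC_one)
  have abcd: "(1 / 2) *\<^sub>C (w1_even 1 + w1_odd 2) = a\<^sub>S" "(1 / 2) *\<^sub>C (w1_odd 1 + w1_even 2) = b\<^sub>S"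
    "(1 / 2) *\<^sub>C (w1_odd 1 - w1_even 2) = c\<^sub>S" "(1 / 2) *\<^sub>C (w1_even 1 - w1_odd 2) = d\<^sub>S"
    by (simp_all add: w1_even_def w1_odd_def half)
  have base: "f \<in> cvs.span ?S" if "f \<in> ?S" for f
    using that by (rule cvs.span_base)
  have "{(1 / 2) *\<^sub>C (w1_even 1 + w1_odd 2), (1 / 2) *\<^sub>C (w1_odd 1 + w1_even 2),
      (1 / 2) *\<^sub>C (w1_odd 1 - w1_even 2), (1 / 2) *\<^sub>C (w1_even 1 - w1_odd 2)} \<subseteq> cvs.span ?S"
    by (intro insert_subsetI empty_subsetI cvs.span_scale cvs.span_add cvs.span_diff base) blast+
  then have "{a\<^sub>S, b\<^sub>S, c\<^sub>S, d\<^sub>S} \<subseteq> cvs.span ?S" unfolding abcd .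
  then have "W 1 \<subseteq> cvs.span ?S"
    unfolding W_1 gens by (intro cvs.span_minimal cvs.subspace_span)
  moreover have "cvs.span ?S \<subseteq> W 1"
    unfolding W_1 gens
    by (intro cvs.span_minimal cvs.subspace_span)
       (auto simp: w1_even_def w1_odd_def intro!: cvs.span_add cvs.span_diff intro: cvs.span_base)
  moreover have "?S = {w1_even 1, w1_odd 1} \<union> {w1_even 2, w1_odd 2}" by blast
  ultimately have "W 1 = cvs.span ({w1_even 1, w1_odd 1} \<union> {w1_even 2, w1_odd 2})"
    by (metis subset_antisym)
  then have sum: "W 1 = {u + v |u v. u \<in> ?U 1 \<and> v \<in> ?U 2}"
    unfolding cvs.span_Un by blast
  have "W 1 = {\<Sum>k\<in>{1, 2}. u k |u. \<forall>k\<in>{1, 2}. u k \<in> ?U k}"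
  proof (intro equalityI subsetI)
    fix x
    assume "x \<in> W 1"
    then obtain u v where "x = u + v" "u \<in> ?U 1" "v \<in> ?U 2" unfolding sum by blast
    then show "x \<in> {\<Sum>k\<in>{1, 2}. u k |u. \<forall>k\<in>{1, 2}. u k \<in> ?U k}"
      unfolding mem_Collect_eq by (intro exI[of _ "\<lambda>k. if k = 1 then u else v"]) simp
  qed (auto simp: sum simp del: One_nat_def)
  moreover have "\<forall>k\<in>{1, 2}. u k = 0"
    if u: "\<forall>k\<in>{1, 2}. u k \<in> ?U k" "(\<Sum>k\<in>{1, 2}. u k) = 0" for u
  proof -
    obtain p q where 1: "u 1 = p *\<^sub>C w1_even 1 + q *\<^sub>C w1_odd 1" using u(1) span_pair by blast
    obtain r s where 2: "u 2 = r *\<^sub>C w1_even 2 + s *\<^sub>C w1_odd 2" using u(1) span_pair by blast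
    have "p *\<^sub>C w1_even 1 + q *\<^sub>C w1_odd 1 + (r *\<^sub>C w1_even 2 + s *\<^sub>C w1_odd 2) = 0"
      using u(2) 1 2 by (simp del: One_nat_def)
    from w1_combination_zero[OF this] show ?thesis using 1 2 by simp
  qed
  ultimately show ?thesis unfolding direct_sum_def by simp
qed

text \<open>The left regular action of \<open>b\<close>: it commutes with the right regular action.\<close>

definition swap :: "S03 \<Rightarrow> S03" where
  "swap f = pairing (coeff [GA]) f *\<^sub>C b\<^sub>S + pairing (coeff [GB]) f *\<^sub>C a\<^sub>S
     - pairing (coeff [GC]) f *\<^sub>C d\<^sub>S - pairing (coeff [GD]) f *\<^sub>C c\<^sub>S"

lemma clinear_swap: "clinear swap"
  by (rule clinearI)
     (simp_all add: swap_def clinearD[OF clinear_pairing] scaleC_add_left scaleC_add_right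
       cvs.scale_right_diff_distrib scaleC_scaleC scaleC_complex_def)

lemmas swap_linear = clinearD[OF clinear_swap]

lemma swap_gens: "swap a\<^sub>S = b\<^sub>S" "swap b\<^sub>S = a\<^sub>S" "swap c\<^sub>S = - d\<^sub>S" "swap d\<^sub>S = - c\<^sub>S"
  by (simp_all add: swap_def scaleC_one)

lemma swap_w1:
  "swap (w1_even 1) = w1_even 2" "swap (w1_odd 1) = w1_odd 2"
  "swap (w1_even 2) = w1_even 1" "swap (w1_odd 2) = w1_odd 1"
  by (simp_all add: w1_even_def w1_odd_def swap_linear swap_gens)

text \<open>Linearity reduces the claim to the four letters, where both sides are explicit by
  \<open>action_gens\<close>.\<close>

lemma swap_equivariant:
  assumes "f \<in> W 1"
  shows "swap (\<pi>\<^sub>R Z f) = \<pi>\<^sub>R Z (swap f)"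
proof (rule linear_eq_on_W[where F = "\<lambda>f. swap (\<pi>\<^sub>R Z f)" and G = "\<lambda>f. \<pi>\<^sub>R Z (swap f)", OF _ _ _ assms])
  show "swap (\<pi>\<^sub>R Z (word_elem w)) = \<pi>\<^sub>R Z (swap (word_elem w))" if len: "length w = 1" for w
  proof -
    obtain x where w: "w = [x]" using len by (auto simp: length_Suc_conv)
    show ?thesis
      by (cases x) (simp_all add: w gen_elem_simps action_gens action_linear swap_linear swap_gens)
  qed
qed (rule clinearI; simp add: action_linear swap_linear)+

lemma isomorphic_w1:
  "isomorphic_rep (cvs.span {w1_even 1, w1_odd 1}) (cvs.span {w1_even 2, w1_odd 2})"
proof -
  let ?U = "cvs.span {w1_even 1, w1_odd 1}" and ?V = "cvs.span {w1_even 2, w1_odd 2}"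
  have "bij_betw swap ?U ?V"
  \<comment> \<open>On these spans \<open>swap\<close> is an involution exchanging the two bases,
    hence its own inverse.\<close>
  proof (rule bij_betw_byWitness[where f' = swap])
    show "\<forall>f\<in>?U. swap (swap f) = f" "\<forall>g\<in>?V. swap (swap g) = g"
      by (auto simp: span_pair swap_linear swap_w1 simp del: One_nat_def)
    show "swap ` ?U \<subseteq> ?V" "swap ` ?V \<subseteq> ?U"
      by (auto simp: span_pair swap_linear swap_w1 simp del: One_nat_def) blast+
  qed
  moreover have "?U \<subseteq> W 1"
    by (intro cvs.span_minimal subspace_W)
       (auto simp: W_1 UNIV_gen gen_elem_simps w1_even_def w1_odd_def
         simp del: One_nat_def intro!: cvs.span_add intro: cvs.span_base)
  ultimately show ?thesis
    unfolding isomorphic_rep_def using swap_equivariant swap_linear(1,2) by blast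
qed

theorem mainTheorem6:
  shows
    "(\<forall>N. subrep (W N) \<and> acts_as A\<^sub>S (of_nat N) (W N))
   \<and> (W 0 = cvs.span {1} \<and> cvs.dim (W 0) = 1 \<and>
      acts_as A\<^sub>S 0 (W 0) \<and> acts_as B\<^sub>S 0 (W 0) \<and> acts_as C\<^sub>S 0 (W 0) \<and> acts_as D\<^sub>S 0 (W 0))
   \<and> (cvs.dim (W 1) = 4 \<and>
      direct_sum {1, 2} (\<lambda>k. cvs.span {w1_even k, w1_odd k}) (W 1) \<and>
      isomorphic_rep (cvs.span {w1_even 1, w1_odd 1}) (cvs.span {w1_even 2, w1_odd 2}) \<and>
      (\<forall>k\<in>{1, 2}.
         irreducible_rep (cvs.span {w1_even k, w1_odd k}) \<and>
         cvs.dim (cvs.span {w1_even k, w1_odd k}) = 2 \<and>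
         cvs.independent {w1_even k, w1_odd k} \<and> w1_even k \<noteq> w1_odd k \<and>
         \<pi>\<^sub>R B\<^sub>S (w1_even k) = w1_odd k \<and> \<pi>\<^sub>R B\<^sub>S (w1_odd k) = w1_even k \<and>
         \<pi>\<^sub>R C\<^sub>S (w1_even k) = - w1_odd k \<and> \<pi>\<^sub>R C\<^sub>S (w1_odd k) = w1_even k \<and>
         \<pi>\<^sub>R D\<^sub>S (w1_even k) = w1_even k \<and> \<pi>\<^sub>R D\<^sub>S (w1_odd k) = - w1_odd k))
   \<and> (cvs.dim (W 2) = 8 \<and>
      direct_sum ({1, 2} \<times> signs \<times> signs) (\<lambda>i. cvs.span {w2 i}) (W 2) \<and>
      (\<forall>k\<in>{1, 2}. \<forall>\<epsilon>\<in>signs. \<forall>\<epsilon>'\<in>signs. one_dim_rep (cvs.span {w2 (k, \<epsilon>, \<epsilon>')}) \<epsilon> \<epsilon>'))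
   \<and> (\<forall>N>2.
      direct_sum (wN_index N) (\<lambda>i. cvs.span {wN i}) (W N) \<and>
      (\<forall>(j, \<epsilon>, \<epsilon>', f)\<in>wN_index N. one_dim_rep (cvs.span {wN (j, \<epsilon>, \<epsilon>', f)}) \<epsilon> \<epsilon>'))
   \<and> (\<forall>N\<ge>2.
      equiv (irreps_in N) (iso_rel N) \<and>
      card (irreps_in N // iso_rel N) = 4 \<and>
      (\<forall>U\<in>irreps_in N. \<exists>\<epsilon>\<in>signs. \<exists>\<epsilon>'\<in>signs. one_dim_rep U \<epsilon> \<epsilon>') \<and>
      bij_betw (\<lambda>(\<epsilon>, \<epsilon>'). {U \<in> irreps_in N. has_character U \<epsilon> \<epsilon>'})
        (signs \<times> signs) (irreps_in N // iso_rel N))"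
proof (intro conjI)
  show "\<forall>N. subrep (W N) \<and> acts_as A\<^sub>S (of_nat N) (W N)"
    by (blast intro: subrep_W A_acts_on_W)
  show "W 0 = cvs.span {1}" by (rule W_0)
  show "cvs.dim (W 0) = 1" unfolding W_0 by (rule dim_span_singleton) simp
  show "acts_as A\<^sub>S 0 (W 0)" "acts_as B\<^sub>S 0 (W 0)" "acts_as C\<^sub>S 0 (W 0)" "acts_as D\<^sub>S 0 (W 0)"
    by (rule acts_on_W_0)+
  show "cvs.dim (W 1) = 4" by (rule dim_W_1)
  show "direct_sum {1, 2} (\<lambda>k. cvs.span {w1_even k, w1_odd k}) (W 1)" by (rule direct_sum_w1)
  show "isomorphic_rep (cvs.span {w1_even 1, w1_odd 1}) (cvs.span {w1_even 2, w1_odd 2})"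
    by (rule isomorphic_w1)
  show "\<forall>k\<in>{1, 2}.
         irreducible_rep (cvs.span {w1_even k, w1_odd k}) \<and>
         cvs.dim (cvs.span {w1_even k, w1_odd k}) = 2 \<and>
         cvs.independent {w1_even k, w1_odd k} \<and> w1_even k \<noteq> w1_odd k \<and>
         \<pi>\<^sub>R B\<^sub>S (w1_even k) = w1_odd k \<and> \<pi>\<^sub>R B\<^sub>S (w1_odd k) = w1_even k \<and>
         \<pi>\<^sub>R C\<^sub>S (w1_even k) = - w1_odd k \<and> \<pi>\<^sub>R C\<^sub>S (w1_odd k) = w1_even k \<and>
         \<pi>\<^sub>R D\<^sub>S (w1_even k) = w1_even k \<and> \<pi>\<^sub>R D\<^sub>S (w1_odd k) = - w1_odd k"
    by (intro ballI conjI; (rule irreducible_w1 w1_independent w1_action; assumption))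
  show "cvs.dim (W 2) = 8" by (rule direct_sum_w2)
  show "direct_sum ({1, 2} \<times> signs \<times> signs) (\<lambda>i. cvs.span {w2 i}) (W 2)" by (rule direct_sum_w2)
  show "\<forall>k\<in>{1, 2}. \<forall>\<epsilon>\<in>signs. \<forall>\<epsilon>'\<in>signs. one_dim_rep (cvs.span {w2 (k, \<epsilon>, \<epsilon>')}) \<epsilon> \<epsilon>'"
    by (intro ballI one_dim_rep_w2)
  show "\<forall>N>2.
      direct_sum (wN_index N) (\<lambda>i. cvs.span {wN i}) (W N) \<and>
      (\<forall>(j, \<epsilon>, \<epsilon>', f)\<in>wN_index N. one_dim_rep (cvs.span {wN (j, \<epsilon>, \<epsilon>', f)}) \<epsilon> \<epsilon>')"
  proof (intro allI impI conjI)
    fix N :: nat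
    assume "2 < N"
    then have N: "2 \<le> N" by simp
    show "direct_sum (wN_index N) (\<lambda>i. cvs.span {wN i}) (W N)" by (rule direct_sum_wN[OF N])
    show "\<forall>(j, \<epsilon>, \<epsilon>', f)\<in>wN_index N. one_dim_rep (cvs.span {wN (j, \<epsilon>, \<epsilon>', f)}) \<epsilon> \<epsilon>'"
      using one_dim_rep_wN[OF N] by blast
  qed
  show "\<forall>N\<ge>2.
      equiv (irreps_in N) (iso_rel N) \<and>
      card (irreps_in N // iso_rel N) = 4 \<and>
      (\<forall>U\<in>irreps_in N. \<exists>\<epsilon>\<in>signs. \<exists>\<epsilon>'\<in>signs. one_dim_rep U \<epsilon> \<epsilon>') \<and>
      bij_betw (\<lambda>(\<epsilon>, \<epsilon>'). {U \<in> irreps_in N. has_character U \<epsilon> \<epsilon>'})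
        (signs \<times> signs) (irreps_in N // iso_rel N)"
  proof (intro allI impI conjI ballI)
    fix N :: nat
    assume N: "2 \<le> N"
    show "equiv (irreps_in N) (iso_rel N)" by (rule iso_classes(1)[OF N])
    show bij: "bij_betw (\<lambda>(\<epsilon>, \<epsilon>'). {U \<in> irreps_in N. has_character U \<epsilon> \<epsilon>'})
        (signs \<times> signs) (irreps_in N // iso_rel N)" by (rule iso_classes(2)[OF N])
    have "card (signs \<times> signs) = 4" by (simp add: signs_def card_cartesian_product)
    then show "card (irreps_in N // iso_rel N) = 4" using bij_betw_same_card[OF bij] by simp
    fix U
    assume "U \<in> irreps_in N"
    then show "\<exists>\<epsilon>\<in>signs. \<exists>\<epsilon>'\<in>signs. one_dim_rep U \<epsilon> \<epsilon>'"
      using irreps_in_character[OF N] by metis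
  qed
qed

end
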